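(* Let $n\ge1$, let $A=\{a_{i,j}\}_{i,j=1,\dots,n}$ be a real-valued $n\times n$ matrix and let the function $f$ on $[0,1[^2$ be defined as $$f(x,y):=a_{i,j},\quad (x,y)\in\left[\frac{i-1}{n},\frac{i}{n}\right[\times\left[\frac{j-1}{n},\frac{j}{n}\right[.$$ Then a copula $C_{\max}$ which attains the maximum $$\max_{C\in\mathcal{C}}\int_{[0,1[^2}f(x,y)\,dC(x,y)$$ is given as the shuffle of $M$ with parameters $\{n,\pi_n,\sigma^*,1\}$, where $\sigma^*$ is a permutation which solves the assignment problem $$\max_{\sigma\in\mathcal{P}}\sum_{i=1}^na_{i,\sigma(i)},$$ $\mathcal{P}$ being the set of all permutations of $\{1,\dots,n\}$. Moreover the maximal value is given by $$\int_{[0,1[^2}f(x,y)\,dC_{\max}(x,y)=\frac1n\sum_{i=1}^na_{i,\sigma^*(i)}.$$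
   Context: $[a,b[$ denotes the half-open interval $\{x:a\le x<b\}$. A (two-)copula is a non-negative function $C$ on the unit square $[0,1]^2$ with $C(x,0)=C(0,y)=0$, $C(x,1)=x$, $C(1,y)=y$ for all $x,y$, and $C(x_2,y_2)-C(x_2,y_1)-C(x_1,y_2)+C(x_1,y_1)\ge0$ whenever $x_1\le x_2$, $y_1\le y_2$. $\mathcal{C}$ is the set of all two-copulas. Integration $dC$ is with respect to the Borel probability measure on the unit square with distribution function $C$. $\pi_n$ is the partition of the unit interval into $n$ intervals of equal length. Shuffle of $M$: let $n\ge1$, $0=s_0<s_1<\dots<s_n=1$, $\sigma$ a permutation of $\{1,\dots,n\}$, and $\omega:\{1,\dots,n\}\to\{-1,1\}$. Let $0=t_0<\dots<t_n=1$ be the partition such that each $[s_{i-1},s_i[\times[t_{\sigma(i)-1},t_{\sigma(i)}[$ is a square. The shuffle of $M$ with parameters $\{n,s,\sigma,\omega\}$ is the copula whose measure, for each $i$, distributes mass $s_i-s_{i-1}$ uniformly along the diagonal (if $\omega(i)=1$) or the antidiagonal (if $\omega(i)=-1$) of the square $[s_{i-1},s_i[\times[t_{\sigma(i)-1},t_{\sigma(i)}[$. The parameter $\omega=1$ means $\omega\equiv1$. *)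

theory Defs
  imports "HOL-Probability.Probability" "HOL-Combinatorics.Permutations"
begin

abbreviation unit_square :: "(real \<times> real) set" where
  "unit_square \<equiv> {0..1} \<times> {0..1}"

text \<open>A copula is a function on the unit square. It is represented by a total function
  whose values outside the square are irrelevant.\<close>

definition copula :: "(real \<Rightarrow> real \<Rightarrow> real) \<Rightarrow> bool" where
  "copula C \<longleftrightarrow>
    (\<forall>x\<in>{0..1}. \<forall>y\<in>{0..1}. 0 \<le> C x y) \<and>
    (\<forall>x\<in>{0..1}. C x 0 = 0) \<and> (\<forall>y\<in>{0..1}. C 0 y = 0) \<and>
    (\<forall>x\<in>{0..1}. C x 1 = x) \<and> (\<forall>y\<in>{0..1}. C 1 y = y) \<and>
    (\<forall>x1\<in>{0..1}. \<forall>x2\<in>{0..1}. \<forall>y1\<in>{0..1}. \<forall>y2\<in>{0..1}. x1 \<le> x2 \<longrightarrow> y1 \<le> y2 \<longrightarrow>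
      C x2 y2 - C x2 y1 - C x1 y2 + C x1 y1 \<ge> 0)"

text \<open>The Borel probability measure on the unit square with distribution function \<open>C\<close>.
  For a copula it exists and is unique; the integral with respect to \<open>dC\<close> is the one
  with respect to this measure.\<close>

definition copula_measure :: "(real \<Rightarrow> real \<Rightarrow> real) \<Rightarrow> (real \<times> real) measure" where
  "copula_measure C = (THE \<mu>.
     sets \<mu> = sets (restrict_space borel unit_square) \<and> prob_space \<mu> \<and>
     (\<forall>x\<in>{0..1}. \<forall>y\<in>{0..1}. measure \<mu> ({0..x} \<times> {0..y}) = C x y))"

text \<open>The parameters \<open>n\<close>, \<open>s\<close>, \<open>\<sigma>\<close>, \<open>\<omega>\<close> of a shuffle are meant to satisfy \<open>n \<ge> 1\<close>,
  \<open>0 = s 0 < s 1 < \<dots> < s n = 1\<close>, \<open>\<sigma> permutes {1..n}\<close> and \<open>\<omega> i \<in> {-1, 1}\<close>; values of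
  \<open>s\<close> beyond \<open>n\<close> and of \<open>\<omega>\<close> outside \<open>{1..n}\<close> are not used.

  The partition \<open>t\<close> is determined by \<open>t 0 = 0\<close> and the requirement that the rectangles
  \<open>{s (i - 1)..<s i} \<times> {t (\<sigma> i - 1)..<t (\<sigma> i)}\<close> are squares (shown below): its \<open>k\<close>-th
  interval has the length of the interval of \<open>s\<close> with number \<open>inv \<sigma> k\<close>.\<close>

definition image_partition :: "(nat \<Rightarrow> real) \<Rightarrow> (nat \<Rightarrow> nat) \<Rightarrow> nat \<Rightarrow> real" where
  "image_partition s \<sigma> j = (\<Sum>k=1..j. s (inv \<sigma> k) - s (inv \<sigma> k - 1))"

lemma image_partition_0: "image_partition s \<sigma> 0 = 0"
  by (simp add: image_partition_def)

lemma image_partition_square: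
  assumes "\<sigma> permutes {1..n}" "i \<in> {1..n}"
  shows "image_partition s \<sigma> (\<sigma> i) - image_partition s \<sigma> (\<sigma> i - 1) = s i - s (i - 1)"
proof -
  have "\<sigma> i \<in> {1..n}"
    using assms by (simp only: permutes_in_image)
  then obtain m where m: "\<sigma> i = Suc m"
    by (cases "\<sigma> i") auto
  have "inv \<sigma> (Suc m) = i"
    using assms(1) m by (metis permutes_inverses(2))
  then show ?thesis
    by (simp add: image_partition_def m)
qed

lemma image_partition_n:
  assumes "\<sigma> permutes {1..n}"
  shows "image_partition s \<sigma> n = s n - s 0"
proof -
  have "image_partition s \<sigma> n = (\<Sum>k\<in>{1..n}. (\<lambda>i. s i - s (i - 1)) (inv \<sigma> k))"
    by (simp add: image_partition_def)
  also have "\<dots> = (\<Sum>i\<in>{1..n}. s i - s (i - 1))"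
    using sum.permute[OF permutes_inv[OF assms], of "\<lambda>i. s i - s (i - 1)"] by (simp add: comp_def)
  also have "\<dots> = s n - s 0"
    by (induction n) auto
  finally show ?thesis .
qed

definition uniform_on_segment :: "real \<times> real \<Rightarrow> real \<times> real \<Rightarrow> (real \<times> real) measure" where
  "uniform_on_segment p q =
     distr (uniform_measure lborel {0..1}) borel (\<lambda>u. (1 - u) *\<^sub>R p + u *\<^sub>R q)"

text \<open>The uniform distribution on the diagonal (\<open>\<omega> i = 1\<close>) or antidiagonal (\<open>\<omega> i = -1\<close>) of
  the \<open>i\<close>-th square. The end points of the segment are a null set, so whether the square
  is half-open or closed does not matter.\<close>

definition shuffle_segment ::
  "(nat \<Rightarrow> real) \<Rightarrow> (nat \<Rightarrow> nat) \<Rightarrow> (nat \<Rightarrow> int) \<Rightarrow> nat \<Rightarrow> (real \<times> real) measure" where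
  "shuffle_segment s \<sigma> \<omega> i =
     (let t = image_partition s \<sigma> in
      if \<omega> i = 1
      then uniform_on_segment (s (i - 1), t (\<sigma> i - 1)) (s i, t (\<sigma> i))
      else uniform_on_segment (s (i - 1), t (\<sigma> i)) (s i, t (\<sigma> i - 1)))"

definition shuffle_measure ::
  "nat \<Rightarrow> (nat \<Rightarrow> real) \<Rightarrow> (nat \<Rightarrow> nat) \<Rightarrow> (nat \<Rightarrow> int) \<Rightarrow> (real \<times> real) measure" where
  "shuffle_measure n s \<sigma> \<omega> =
     measure_of unit_square (sets (restrict_space borel unit_square))
       (\<lambda>B. \<Sum>i\<in>{1..n}. ennreal (s i - s (i - 1)) * emeasure (shuffle_segment s \<sigma> \<omega> i) B)"

lemma sets_shuffle_segment: "sets (shuffle_segment s \<sigma> \<omega> i) = sets borel"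
  by (simp add: shuffle_segment_def uniform_on_segment_def Let_def)

lemma sets_shuffle_measure:
  "sets (shuffle_measure n s \<sigma> \<omega>) = sets (restrict_space borel unit_square)"
proof -
  have sp: "space (restrict_space borel unit_square) = unit_square"
    by (simp add: space_restrict_space)
  show ?thesis
    unfolding shuffle_measure_def
    using sets.sigma_sets_eq[of "restrict_space borel unit_square"] sets.space_closed[of "restrict_space borel unit_square"]
    by (simp add: sp)
qed

lemma emeasure_shuffle_measure:
  assumes "B \<in> sets (restrict_space borel unit_square)"
  shows "emeasure (shuffle_measure n s \<sigma> \<omega>) B =
    (\<Sum>i\<in>{1..n}. ennreal (s i - s (i - 1)) * emeasure (shuffle_segment s \<sigma> \<omega> i) B)"
proof (rule emeasure_measure_of[OF shuffle_measure_def])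
  let ?R = "restrict_space borel unit_square"
  let ?\<mu> = "\<lambda>B. \<Sum>i\<in>{1..n}. ennreal (s i - s (i - 1)) * emeasure (shuffle_segment s \<sigma> \<omega> i) B"
  have "unit_square \<in> sets borel"
    by (intro borel_closed closed_Times closed_real_atLeastAtMost)
  then have sub: "sets ?R \<subseteq> sets borel"
    by (auto simp: sets_restrict_space)
  show "sets ?R \<subseteq> Pow unit_square"
    by (auto simp: sets_restrict_space)
  show B: "B \<in> sets (shuffle_measure n s \<sigma> \<omega>)"
    using assms by (simp add: sets_shuffle_measure)
  show "positive (sets (shuffle_measure n s \<sigma> \<omega>)) ?\<mu>"
    by (simp add: positive_def)
  show "countably_additive (sets (shuffle_measure n s \<sigma> \<omega>)) ?\<mu>"
  proof (rule countably_additiveI)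
    fix A :: "nat \<Rightarrow> (real \<times> real) set"
    assume "range A \<subseteq> sets (shuffle_measure n s \<sigma> \<omega>)" and d: "disjoint_family A"
    then have A: "range A \<subseteq> sets (shuffle_segment s \<sigma> \<omega> i)" for i
      using sub by (auto simp: sets_shuffle_measure sets_shuffle_segment)
    have "(\<Sum>k. ?\<mu> (A k)) =
        (\<Sum>i\<in>{1..n}. \<Sum>k. ennreal (s i - s (i - 1)) * emeasure (shuffle_segment s \<sigma> \<omega> i) (A k))"
      by (intro suminf_sum) simp
    also have "\<dots> = ?\<mu> (\<Union>k. A k)"
      by (intro sum.cong refl) (simp add: ennreal_suminf_cmult suminf_emeasure[OF A d])
    finally show "(\<Sum>k. ?\<mu> (A k)) = ?\<mu> (\<Union>k. A k)" .
  qed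
qed

text \<open>The shuffle of M, as the distribution function of its measure.\<close>

definition shuffle_of_M ::
  "nat \<Rightarrow> (nat \<Rightarrow> real) \<Rightarrow> (nat \<Rightarrow> nat) \<Rightarrow> (nat \<Rightarrow> int) \<Rightarrow> real \<Rightarrow> real \<Rightarrow> real" where
  "shuffle_of_M n s \<sigma> \<omega> x y = measure (shuffle_measure n s \<sigma> \<omega>) ({0..x} \<times> {0..y})"

definition equal_partition :: "nat \<Rightarrow> nat \<Rightarrow> real" where
  "equal_partition n i = real i / real n"

definition copula_integral :: "(real \<times> real \<Rightarrow> real) \<Rightarrow> (real \<Rightarrow> real \<Rightarrow> real) \<Rightarrow> real" where
  "copula_integral f C = (LINT z:{0..<1} \<times> {0..<1}|copula_measure C. f z)"

end

(*
  The integral of f against a copula is the sum of the a i j weighted by the masses of the grid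
  cells, and n times these masses form a doubly stochastic matrix. Such a weighted sum is at most
  its value at an optimal permutation: after permuting the columns the optimum is the identity, and
  any matrix with equal row and column sums is reduced to its diagonal by subtracting permutations.
  The shuffle of the optimal permutation puts mass 1/n on each of its n cells, so it attains the bound.

  Integration with respect to a copula C needs a measure with distribution function C. It is the
  image of Lebesgue measure on [0,1[ under a map that sends nested intervals to nested dyadic
  squares, the length of an interval being the C-volume of its square.
*)
theory Submission
  imports Defs
begin

section \<open>The assignment problem over doubly stochastic matrices\<close>


text \<open>\<open>copula_measure\<close> is a definite description, so an integral against an
  arbitrary copula carries no information until existence and uniqueness of the measure are proved.
  Taking an image of Lebesgue measure makes countable additivity automatic; only the values on
  rectangles remain to be found. They cannot be read off exactly from one dyadic level, since a
  limit point may lie on the edge of its cell. They are squeezed between two unions of cells, and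
  the Lipschitz bound for copulas closes the gap.

  For the bound, the property carried through the induction is that row \<open>i\<close> and column
  \<open>i\<close> have the same sum for each \<open>i\<close>. It survives when a permutation of
  only some of the indices is subtracted, so such a permutation is found by following nonzero
  entries until they close up, in place of a matching argument.

  Distribution functions speak of closed rectangles, while the grid and the domain of
  \<open>f\<close> are half-open. The difference consists of lines that are null because the
  marginals are uniform.\<close>

lemma finite_self_map_bij_betw:
  assumes "finite T" "T \<noteq> {}" "g ` T \<subseteq> T"
  obtains U where "U \<subseteq> T" "U \<noteq> {}" "bij_betw g U U"
proof -
  let ?F = "{U. U \<subseteq> T \<and> U \<noteq> {} \<and> g ` U \<subseteq> U}"
  have "finite ?F" "?F \<noteq> {}"
    using assms by auto
  then obtain U where U: "U \<in> ?F" "\<forall>V\<in>?F. V \<subseteq> U \<longrightarrow> U = V"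
    by (rule finite_has_minimal[THEN bexE])
  \<comment> \<open>The image of an invariant set is again invariant and lies inside it, so
    minimality forces equality. On a finite set a surjection is a bijection.\<close>
  have "g ` U \<in> ?F" "g ` U \<subseteq> U"
    using U(1) by auto
  with U(2) have "g ` U = U"
    by (metis (no_types, lifting))
  moreover have "finite U"
    using U(1) assms(1) finite_subset by auto
  ultimately have "bij_betw g U U"
    by (auto simp: bij_betw_def intro: eq_card_imp_inj_on)
  with U(1) show ?thesis
    by (intro that[of U]) auto
qed

text \<open>As long as the circulation \<open>d\<close> has an off-diagonal entry, every index with positive off-diagonal
  outflow has a successor of the same kind. A minimal set closed under the successor map carries a
  permutation inside the support of \<open>d\<close>; subtracting the largest possible multiple of it
  kills an entry of \<open>d\<close> and does not lower the cost.\<close>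

lemma circulation_cost_nonpos:
  fixes d w :: "'a \<Rightarrow> 'a \<Rightarrow> real"
  assumes "finite S"
    and "\<And>i j. i \<in> S \<Longrightarrow> j \<in> S \<Longrightarrow> 0 \<le> d i j"
    and "\<And>i. i \<in> S \<Longrightarrow> (\<Sum>j\<in>S. d i j) = (\<Sum>j\<in>S. d j i)"
    and w0: "\<And>i. i \<in> S \<Longrightarrow> w i i = 0"
    and w: "\<And>\<tau>. \<tau> permutes S \<Longrightarrow> (\<Sum>i\<in>S. w i (\<tau> i)) \<le> 0"
  shows "(\<Sum>i\<in>S. \<Sum>j\<in>S. d i j * w i j) \<le> 0"
  using assms(2,3)
proof (induction "card {(i, j). i \<in> S \<and> j \<in> S \<and> i \<noteq> j \<and> d i j \<noteq> 0}" arbitrary: d rule: less_induct)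
  case less
  let ?N = "\<lambda>d. {(i, j). i \<in> S \<and> j \<in> S \<and> i \<noteq> j \<and> d i j \<noteq> (0::real)}"
  define T where "T = {i \<in> S. \<exists>j\<in>S. j \<noteq> i \<and> d i j \<noteq> 0}"
  have finN: "finite (?N d)" for d
    by (rule finite_subset[of _ "S \<times> S"]) (use assms(1) in auto)
  show ?case
  proof (cases "T = {}")
    case True
    then have "d i j * w i j = 0" if "i \<in> S" "j \<in> S" for i j
      using that w0 by (cases "i = j") (auto simp: T_def)
    then have "(\<Sum>i\<in>S. \<Sum>j\<in>S. d i j * w i j) = 0"
      by (intro sum.neutral ballI)
    then show ?thesis
      by simp
  next
    case False
    have *: "\<forall>i\<in>T. \<exists>j. j \<in> S \<and> j \<noteq> i \<and> d i j \<noteq> 0"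
      by (auto simp: T_def)
    obtain g where g: "\<And>i. i \<in> T \<Longrightarrow> g i \<in> S \<and> g i \<noteq> i \<and> d i (g i) \<noteq> 0"
      using bchoice[OF *] by blast
    \<comment> \<open>If \<open>g i\<close> had no off-diagonal outflow, the balance of row and
      column at \<open>g i\<close> would leave it no off-diagonal inflow either, but the entry from
      \<open>i\<close> is one.\<close>
    have "g i \<in> T" if i: "i \<in> T" for i
    proof (rule ccontr)
      assume "g i \<notin> T"
      then have z: "d (g i) j = 0" if "j \<in> S - {g i}" for j
        using g[OF i] that by (auto simp: T_def)
      have gi: "g i \<in> S" and iS: "i \<in> S - {g i}"
        using g[OF i] i by (auto simp: T_def)
      have "(\<Sum>j\<in>S - {g i}. d j (g i)) = (\<Sum>j\<in>S - {g i}. d (g i) j)"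
        using less.prems(2)[OF gi] assms(1) gi by (simp add: sum.remove)
      also have "\<dots> = 0"
        using z by simp
      finally have "d i (g i) = 0"
        using less.prems(1) gi iS assms(1)
        by (subst (asm) sum_nonneg_eq_0_iff) auto
      with g[OF i] show False
        by simp
    qed
    then have "g ` T \<subseteq> T" by auto
    moreover have "finite T"
      using assms(1) by (simp add: T_def)
    ultimately obtain U where U: "U \<subseteq> T" "U \<noteq> {}" "bij_betw g U U"
      using False finite_self_map_bij_betw by metis
    have US: "U \<subseteq> S" using U(1) by (auto simp: T_def)
    have finU: "finite U" using US assms(1) finite_subset by blast
    define \<tau> where "\<tau> i = (if i \<in> U then g i else i)" for i
    have "\<tau> permutes U"
    proof (rule bij_imp_permutes)
      show "bij_betw \<tau> U U"
        using U(3) by (rule bij_betw_cong[THEN iffD1, rotated]) (simp add: \<tau>_def)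
    qed (simp add: \<tau>_def)
    then have \<tau>: "\<tau> permutes S"
      using US permutes_subset by blast
    define \<epsilon> where "\<epsilon> = Min ((\<lambda>i. d i (\<tau> i)) ` U)"
    have pos: "0 < d i (\<tau> i)" if "i \<in> U" for i
      using g[of i] less.prems(1)[of i "g i"] U(1) US that by (force simp: \<tau>_def)
    have \<epsilon>_le: "\<epsilon> \<le> d i (\<tau> i)" if "i \<in> U" for i
      using that finU by (simp add: \<epsilon>_def)
    have "\<epsilon> \<in> (\<lambda>i. d i (\<tau> i)) ` U"
      unfolding \<epsilon>_def using finU U(2) by (intro Min_in) auto
    then obtain k where k: "k \<in> U" "\<epsilon> = d k (\<tau> k)"
      by blast
    have \<epsilon>0: "0 < \<epsilon>" using k pos by simp
    \<comment> \<open>\<open>e\<close> carries only the part of \<open>\<tau>\<close> on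
      \<open>U\<close>: at the fixed points outside \<open>U\<close> the diagonal of
      \<open>d\<close> may be zero. Row and column sums at the same index still drop by the same
      amount. As \<open>w\<close> vanishes on the diagonal, the cost of \<open>e\<close> is
      \<open>\<epsilon>\<close> times that of all of \<open>\<tau>\<close>.\<close>
    define e where "e i j = (if i \<in> U \<and> j = \<tau> i then \<epsilon> else 0)" for i j
    have \<tau>S: "\<tau> i \<in> S" if "i \<in> S" for i
      using \<tau> that by (simp add: permutes_in_image)
    have e_row: "(\<Sum>j\<in>S. e i j * x j) = (if i \<in> U then \<epsilon> * x (\<tau> i) else 0)" if "i \<in> S" for i x
    proof -
      have "(\<Sum>j\<in>S. e i j * x j) = (\<Sum>j\<in>S. if j = \<tau> i then (if i \<in> U then \<epsilon> * x j else 0) else 0)"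
        by (intro sum.cong) (auto simp: e_def)
      also have "\<dots> = (if i \<in> U then \<epsilon> * x (\<tau> i) else 0)"
        using assms(1) \<tau>S[OF that] by simp
      finally show ?thesis .
    qed
    have e_col: "(\<Sum>j\<in>S. e j i) = (if i \<in> U then \<epsilon> else 0)" if "i \<in> S" for i
    proof -
      have "(\<Sum>j\<in>S. e j i) = (\<Sum>j\<in>S. if j = inv \<tau> i then (if i \<in> U then \<epsilon> else 0) else 0)"
        using permutes_inverses[OF \<open>\<tau> permutes U\<close>] permutes_in_image[OF \<open>\<tau> permutes U\<close>]
          permutes_in_image[OF permutes_inv[OF \<open>\<tau> permutes U\<close>]]
        by (intro sum.cong) (auto simp: e_def)
      also have "\<dots> = (if i \<in> U then \<epsilon> else 0)"
        using assms(1) that permutes_in_image[OF permutes_inv[OF \<tau>]] by simp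
      finally show ?thesis .
    qed
    define d' where "d' i j = d i j - e i j" for i j
    have "(\<Sum>i\<in>S. \<Sum>j\<in>S. d' i j * w i j) \<le> 0"
    proof (rule less.hyps)
      have "?N d' \<subseteq> ?N d"
        using pos[THEN less_imp_neq] by (auto simp: d'_def e_def split: if_splits)
      moreover have "(k, \<tau> k) \<in> ?N d - ?N d'"
        using k \<epsilon>0 US \<tau>S g[of k] U(1) by (auto simp: d'_def e_def \<tau>_def)
      ultimately show "card (?N d') < card (?N d)"
        by (intro psubset_card_mono finN) auto
      show "0 \<le> d' i j" if "i \<in> S" "j \<in> S" for i j
        using less.prems(1)[OF that] \<epsilon>_le by (auto simp: d'_def e_def)
      show "(\<Sum>j\<in>S. d' i j) = (\<Sum>j\<in>S. d' j i)" if "i \<in> S" for i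
        using less.prems(2)[OF that] e_row[OF that, of "\<lambda>_. 1"] e_col[OF that]
        by (simp add: d'_def sum_subtractf)
    qed
    moreover have "(\<Sum>i\<in>S. \<Sum>j\<in>S. d i j * w i j) =
        (\<Sum>i\<in>S. \<Sum>j\<in>S. d' i j * w i j) + \<epsilon> * (\<Sum>i\<in>S. w i (\<tau> i))"
    proof -
      have "(\<Sum>i\<in>S. \<Sum>j\<in>S. e i j * w i j) = (\<Sum>i\<in>S. \<epsilon> * w i (\<tau> i))"
        by (intro sum.cong refl) (auto simp: e_row w0 \<tau>_def)
      then show ?thesis
        by (simp add: d'_def left_diff_distrib sum_subtractf sum_distrib_left)
    qed
    ultimately show ?thesis
      using w[OF \<tau>] \<epsilon>0 by (smt (verit) mult_pos_pos mult_nonneg_nonpos)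
  qed
qed

text \<open>Relabelling the columns by \<open>\<sigma>\<close> and subtracting
  \<open>a i (\<sigma> i)\<close> from row \<open>i\<close> of the costs makes the diagonal costs
  zero, and optimality of \<open>\<sigma>\<close> becomes nonpositive cost of every permutation. The
  subtraction changes the weighted sum by a fixed amount, because every row of \<open>d\<close> sums
  to \<open>c\<close>. A general \<open>c\<close> allows cell masses to be inserted without
  rescaling.\<close>

lemma assignment_bound:
  fixes a d :: "'a \<Rightarrow> 'a \<Rightarrow> real"
  assumes "finite S"
    and nonneg: "\<And>i j. i \<in> S \<Longrightarrow> j \<in> S \<Longrightarrow> 0 \<le> d i j"
    and row: "\<And>i. i \<in> S \<Longrightarrow> (\<Sum>j\<in>S. d i j) = c"
    and col: "\<And>j. j \<in> S \<Longrightarrow> (\<Sum>i\<in>S. d i j) = c"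
    and opt: "is_arg_max (\<lambda>\<sigma>. \<Sum>i\<in>S. a i (\<sigma> i)) (\<lambda>\<sigma>. \<sigma> permutes S) \<sigma>"
  shows "(\<Sum>i\<in>S. \<Sum>j\<in>S. d i j * a i j) \<le> c * (\<Sum>i\<in>S. a i (\<sigma> i))"
proof -
  have \<sigma>: "\<sigma> permutes S"
    and max: "\<And>\<tau>. \<tau> permutes S \<Longrightarrow> (\<Sum>i\<in>S. a i (\<tau> i)) \<le> (\<Sum>i\<in>S. a i (\<sigma> i))"
    using opt by (auto simp: is_arg_max_def not_less)
  have perm: "(\<Sum>j\<in>S. h (\<sigma> j)) = (\<Sum>j\<in>S. h j)" for h :: "'a \<Rightarrow> real"
    using sum.permute[OF \<sigma>, of h] by (simp add: comp_def)
  have in_S: "\<sigma> i \<in> S" if "i \<in> S" for i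
    using that \<sigma> by (simp add: permutes_in_image)
  have "(\<Sum>i\<in>S. \<Sum>j\<in>S. d i (\<sigma> j) * (a i (\<sigma> j) - a i (\<sigma> i))) \<le> 0"
  proof (rule circulation_cost_nonpos[OF assms(1)])
    show "(\<Sum>j\<in>S. d i (\<sigma> j)) = (\<Sum>j\<in>S. d j (\<sigma> i))" if "i \<in> S" for i
      using that in_S perm[of "d i"] row col by simp
    show "(\<Sum>i\<in>S. a i (\<sigma> (\<tau> i)) - a i (\<sigma> i)) \<le> 0" if "\<tau> permutes S" for \<tau>
      using max[OF permutes_compose[OF that \<sigma>]] by (simp add: sum_subtractf)
  qed (use nonneg in_S in auto)
  moreover have "(\<Sum>j\<in>S. d i (\<sigma> j) * (a i (\<sigma> j) - a i (\<sigma> i))) =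
      (\<Sum>j\<in>S. d i j * a i j) - c * a i (\<sigma> i)" if "i \<in> S" for i
    using perm[of "\<lambda>j. d i j * a i j"] perm[of "\<lambda>j. d i j * a i (\<sigma> i)"] row[OF that]
    by (simp add: right_diff_distrib sum_subtractf flip: sum_distrib_right)
  ultimately show ?thesis
    by (simp add: sum_subtractf sum_distrib_left)
qed

section \<open>Existence of the measure of a copula\<close>


definition rect_vol :: "(real \<Rightarrow> real \<Rightarrow> real) \<Rightarrow> real \<Rightarrow> real \<Rightarrow> real \<Rightarrow> real \<Rightarrow> real" where
  "rect_vol C x1 x2 y1 y2 = C x2 y2 - C x2 y1 - C x1 y2 + C x1 y1"

definition cell_vol :: "(real \<Rightarrow> real \<Rightarrow> real) \<Rightarrow> nat \<Rightarrow> nat \<Rightarrow> nat \<Rightarrow> real" where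
  "cell_vol C m i j =
     rect_vol C (real i / 2 ^ m) (real (Suc i) / 2 ^ m) (real j / 2 ^ m) (real (Suc j) / 2 ^ m)"

text \<open>Cell \<open>(i, j)\<close> of level \<open>m\<close> is the dyadic square with lower left corner \<open>(i / 2 ^ m, j / 2 ^ m)\<close>.
  To it belongs an interval whose length is the mass of the cell; the intervals of the four
  subcells of a cell are lined up inside the interval of the cell, column by column.\<close>

fun cell_start :: "(real \<Rightarrow> real \<Rightarrow> real) \<Rightarrow> nat \<Rightarrow> nat \<Rightarrow> nat \<Rightarrow> real" where
  "cell_start C 0 i j = 0"
| "cell_start C (Suc m) i j = cell_start C m (i div 2) (j div 2) +
     (if even i then 0
      else cell_vol C (Suc m) (i - 1) (2 * (j div 2)) + cell_vol C (Suc m) (i - 1) (Suc (2 * (j div 2)))) +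
     (if even j then 0 else cell_vol C (Suc m) i (j - 1))"

text \<open>Half-open, so that the intervals of the subcells tile that of their parent exactly. A
  cell without mass gets the empty interval.\<close>

definition cell_interval :: "(real \<Rightarrow> real \<Rightarrow> real) \<Rightarrow> nat \<Rightarrow> nat \<Rightarrow> nat \<Rightarrow> real set" where
  "cell_interval C m i j = {cell_start C m i j ..< cell_start C m i j + cell_vol C m i j}"


section \<open>Masses of dyadic cells and the nesting of their intervals\<close>

lemma copula_2_increasing:
  assumes "copula C" "0 \<le> x1" "x1 \<le> x2" "x2 \<le> 1" "0 \<le> y1" "y1 \<le> y2" "y2 \<le> 1"
  shows "0 \<le> rect_vol C x1 x2 y1 y2"
proof -
  have "\<forall>x1\<in>{0..1}. \<forall>x2\<in>{0..1}. \<forall>y1\<in>{0..1}. \<forall>y2\<in>{0..1}. x1 \<le> x2 \<longrightarrow> y1 \<le> y2 \<longrightarrow>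
      0 \<le> C x2 y2 - C x2 y1 - C x1 y2 + C x1 y1"
    using assms(1) unfolding copula_def by (elim conjE)
  then show ?thesis
    using assms(2-) by (simp add: rect_vol_def)
qed

lemma copula_boundary:
  assumes "copula C" "t \<in> {0..1}"
  shows "C t 0 = 0" "C 0 t = 0" "C t 1 = t" "C 1 t = t"
proof -
  have "\<forall>x\<in>{0..1}. C x 0 = 0" "\<forall>y\<in>{0..1}. C 0 y = 0" "\<forall>x\<in>{0..1}. C x 1 = x" "\<forall>y\<in>{0..1}. C 1 y = y"
    using assms(1) unfolding copula_def by simp_all
  then show "C t 0 = 0" "C 0 t = 0" "C t 1 = t" "C 1 t = t"
    using assms(2) by (auto simp only:)
qed


text \<open>Extending a rectangle in one direction adds at most the mass of the full strip of that
  width, which the uniform marginals give. This is the continuity that controls dyadic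
  approximation.\<close>

lemma copula_lipschitz:
  assumes "copula C" "0 \<le> x" "x \<le> x'" "x' \<le> 1" "0 \<le> y" "y \<le> y'" "y' \<le> 1"
  shows "C x' y' \<le> C x y + (x' - x) + (y' - y)"
proof -
  have "0 \<le> rect_vol C x x' y 1" "0 \<le> rect_vol C x' 1 y y'"
    using assms by (auto intro!: copula_2_increasing)
  moreover have "C x 1 = x" "C x' 1 = x'" "C 1 y = y" "C 1 y' = y'"
    using assms by (auto intro!: copula_boundary[OF assms(1)])
  ultimately show ?thesis
    by (simp add: rect_vol_def)
qed

lemma cell_vol_nonneg:
  assumes "copula C" "i < 2 ^ m" "j < 2 ^ m"
  shows "0 \<le> cell_vol C m i j"
proof -
  have "real (Suc k) / 2 ^ m \<le> 1" if "k < 2 ^ m" for k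
  proof -
    have "real (Suc k) \<le> real (2 ^ m)"
      using that by (subst of_nat_le_iff) simp
    then show ?thesis
      by (simp add: divide_le_eq)
  qed
  then show ?thesis
    unfolding cell_vol_def using assms by (intro copula_2_increasing) (auto simp: divide_right_mono)
qed

lemma cell_vol_refine:
  "cell_vol C (Suc m) (2 * i) (2 * j) + cell_vol C (Suc m) (2 * i) (Suc (2 * j)) +
   cell_vol C (Suc m) (Suc (2 * i)) (2 * j) + cell_vol C (Suc m) (Suc (2 * i)) (Suc (2 * j)) =
   cell_vol C m i j"
proof -
  have "real (2 * k) / 2 ^ Suc m = real k / 2 ^ m"
       "real (Suc (Suc (2 * k))) / 2 ^ Suc m = real (Suc k) / 2 ^ m" for k
    by (simp_all add: field_simps)
  then show ?thesis
    unfolding cell_vol_def rect_vol_def by (simp only:)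
qed

text \<open>The four subintervals have consecutive end points, ordered because the masses are
  nonnegative; by \<open>cell_vol_refine\<close> the last one ends where the parent does.\<close>

lemma cell_interval_refine:
  assumes "copula C" "i < 2 ^ m" "j < 2 ^ m"
  shows "u \<in> cell_interval C m i j \<longleftrightarrow>
    (\<exists>i' j'. i' div 2 = i \<and> j' div 2 = j \<and> u \<in> cell_interval C (Suc m) i' j')" (is ?refine)
    and "u \<in> cell_interval C (Suc m) i1 j1 \<Longrightarrow> u \<in> cell_interval C (Suc m) i2 j2 \<Longrightarrow>
      i1 div 2 = i \<Longrightarrow> i2 div 2 = i \<Longrightarrow> j1 div 2 = j \<Longrightarrow> j2 div 2 = j \<Longrightarrow> i1 = i2 \<and> j1 = j2"
proof -
  let ?v = "cell_vol C (Suc m)"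
  have half: "k' div 2 = k \<longleftrightarrow> k' = 2 * k \<or> k' = Suc (2 * k)" for k k' :: nat
    by presburger
  have ex: "(\<exists>k'. k' div 2 = k \<and> P k') \<longleftrightarrow> P (2 * k) \<or> P (Suc (2 * k))" for k :: nat and P
    unfolding half by blast
  define s a b c d where "s = cell_start C m i j" and "a = ?v (2 * i) (2 * j)"
    and "b = ?v (2 * i) (Suc (2 * j))" and "c = ?v (Suc (2 * i)) (2 * j)"
    and "d = ?v (Suc (2 * i)) (Suc (2 * j))"
  have nonneg: "0 \<le> a" "0 \<le> b" "0 \<le> c" "0 \<le> d"
    unfolding a_def b_def c_def d_def using assms by (auto intro!: cell_vol_nonneg)
  have parent: "cell_interval C m i j = {s..<s + (a + b + c + d)}"
    by (simp add: cell_interval_def s_def a_def b_def c_def d_def cell_vol_refine[symmetric, of C m i j])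
  let ?I = "cell_interval C (Suc m)"
  have iv:
      "?I (2 * i) (2 * j) = {s..<s + a}"
      "?I (2 * i) (Suc (2 * j)) = {s + a..<s + a + b}"
      "?I (Suc (2 * i)) (2 * j) = {s + (a + b)..<s + (a + b) + c}"
      "?I (Suc (2 * i)) (Suc (2 * j)) = {s + (a + b) + c..<s + (a + b) + c + d}"
    by (simp_all add: cell_interval_def s_def a_def b_def c_def d_def)
  have "(\<exists>i' j'. i' div 2 = i \<and> j' div 2 = j \<and> u \<in> cell_interval C (Suc m) i' j') \<longleftrightarrow>
    (\<exists>i'. i' div 2 = i \<and> (\<exists>j'. j' div 2 = j \<and> u \<in> cell_interval C (Suc m) i' j'))"
    by blast
  then show ?refine
    unfolding ex parent iv atLeastLessThan_iff using nonneg by argo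
  have disj: "?I (2 * i) (2 * j) \<inter> ?I (2 * i) (Suc (2 * j)) = {}"
      "?I (2 * i) (2 * j) \<inter> ?I (Suc (2 * i)) (2 * j) = {}"
      "?I (2 * i) (2 * j) \<inter> ?I (Suc (2 * i)) (Suc (2 * j)) = {}"
      "?I (2 * i) (Suc (2 * j)) \<inter> ?I (Suc (2 * i)) (2 * j) = {}"
      "?I (2 * i) (Suc (2 * j)) \<inter> ?I (Suc (2 * i)) (Suc (2 * j)) = {}"
      "?I (Suc (2 * i)) (2 * j) \<inter> ?I (Suc (2 * i)) (Suc (2 * j)) = {}"
    unfolding iv disjoint_iff atLeastLessThan_iff using nonneg by - (rule allI, argo)+
  show "i1 = i2 \<and> j1 = j2" if u: "u \<in> ?I i1 j1" "u \<in> ?I i2 j2"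
    and "i1 div 2 = i" "i2 div 2 = i" "j1 div 2 = j" "j2 div 2 = j"
    using that(3-6)[unfolded half] u disj by auto
qed

text \<open>Induction on the level, starting from [0,1[ because \<open>C 1 1\<close> is 1. Two cells
  of the next level that share \<open>u\<close> have parents that share \<open>u\<close>, so the
  parents agree by induction and the cells agree by the refinement lemma.\<close>

lemma cell_interval_partition:
  assumes "copula C"
  shows "u \<in> {0..<1} \<longleftrightarrow> (\<exists>i j. i < 2 ^ m \<and> j < 2 ^ m \<and> u \<in> cell_interval C m i j)" (is "_ \<longleftrightarrow> ?ex m")
    and "i < 2 ^ m \<Longrightarrow> j < 2 ^ m \<Longrightarrow> i' < 2 ^ m \<Longrightarrow> j' < 2 ^ m \<Longrightarrow>
      u \<in> cell_interval C m i j \<Longrightarrow> u \<in> cell_interval C m i' j' \<Longrightarrow> i = i' \<and> j = j'"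
proof -
  have "(u \<in> {0..<1} \<longleftrightarrow> ?ex m) \<and> (\<forall>i j i' j'. i < 2 ^ m \<longrightarrow> j < 2 ^ m \<longrightarrow> i' < 2 ^ m \<longrightarrow> j' < 2 ^ m \<longrightarrow>
      u \<in> cell_interval C m i j \<longrightarrow> u \<in> cell_interval C m i' j' \<longrightarrow> i = i' \<and> j = j')"
  proof (induction m)
    case 0
    show ?case
      using assms by (auto simp: cell_interval_def cell_vol_def rect_vol_def copula_boundary)
  next
    case (Suc m)
    have lt: "k < 2 ^ Suc m \<longleftrightarrow> k div 2 < 2 ^ m" for k :: nat
      by auto
    have "?ex (Suc m) \<longleftrightarrow> ?ex m"
      unfolding lt using cell_interval_refine(1)[OF assms, of _ m _ u] by blast
    moreover have "i = i' \<and> j = j'"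
      if "i div 2 < 2 ^ m" "j div 2 < 2 ^ m" "i' div 2 < 2 ^ m" "j' div 2 < 2 ^ m"
        "u \<in> cell_interval C (Suc m) i j" "u \<in> cell_interval C (Suc m) i' j'" for i j i' j'
      using that Suc cell_interval_refine[OF assms, of _ m _ u] by metis
    ultimately show ?case
      using Suc unfolding lt by blast
  qed
  then show "u \<in> {0..<1} \<longleftrightarrow> ?ex m"
    and "i < 2 ^ m \<Longrightarrow> j < 2 ^ m \<Longrightarrow> i' < 2 ^ m \<Longrightarrow> j' < 2 ^ m \<Longrightarrow>
      u \<in> cell_interval C m i j \<Longrightarrow> u \<in> cell_interval C m i' j' \<Longrightarrow> i = i' \<and> j = j'"
    by blast+
qed

lemma cell_vol_telescope:
  assumes "copula C" "k \<le> 2 ^ m" "l \<le> 2 ^ m"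
  shows "(\<Sum>i<k. \<Sum>j<l. cell_vol C m i j) = C (real k / 2 ^ m) (real l / 2 ^ m)"
proof -
  have *: "real i / 2 ^ m \<in> {0..1}" if "i \<le> 2 ^ m" for i
    using of_nat_mono[OF that, where 'a = real] by (simp add: divide_le_eq)
  have "(\<Sum>j<l. cell_vol C m i j) = (\<Sum>j<l.
      (C (real (Suc i) / 2 ^ m) (real (Suc j) / 2 ^ m) - C (real (Suc i) / 2 ^ m) (real j / 2 ^ m)) -
      (C (real i / 2 ^ m) (real (Suc j) / 2 ^ m) - C (real i / 2 ^ m) (real j / 2 ^ m)))" for i
    by (intro sum.cong refl) (simp add: cell_vol_def rect_vol_def)
  then have "(\<Sum>j<l. cell_vol C m i j) =
      (C (real (Suc i) / 2 ^ m) (real l / 2 ^ m) - C (real (Suc i) / 2 ^ m) 0) -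
      (C (real i / 2 ^ m) (real l / 2 ^ m) - C (real i / 2 ^ m) 0)" for i
    using sum_lessThan_telescope[of "\<lambda>j. C (real (Suc i) / 2 ^ m) (real j / 2 ^ m)" l]
      sum_lessThan_telescope[of "\<lambda>j. C (real i / 2 ^ m) (real j / 2 ^ m)" l]
    by (simp only: sum_subtractf) simp
  moreover define F where "F i = C (real i / 2 ^ m) (real l / 2 ^ m) - C (real i / 2 ^ m) 0" for i
  ultimately have "(\<Sum>i<k. \<Sum>j<l. cell_vol C m i j) = (\<Sum>i<k. F (Suc i) - F i)"
    by simp
  also have "\<dots> = F k - F 0"
    by (rule sum_lessThan_telescope)
  also have "\<dots> = C (real k / 2 ^ m) (real l / 2 ^ m)"
    using *[OF assms(2)] *[OF assms(3)] assms(1) by (simp add: F_def copula_boundary)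
  finally show ?thesis .
qed

text \<open>With \<open>g\<close> equal to \<open>fst\<close> or \<open>snd\<close> this is one
  coordinate of the lower left corner of the cell to which \<open>u\<close> belongs. Written as a
  sum of indicators it is visibly measurable, and it is 0 for \<open>u\<close> outside
  [0,1[.\<close>

definition cell_coord :: "(nat \<times> nat \<Rightarrow> nat) \<Rightarrow> (real \<Rightarrow> real \<Rightarrow> real) \<Rightarrow> nat \<Rightarrow> real \<Rightarrow> real" where
  "cell_coord g C m u = (\<Sum>p\<in>{..<2 ^ m} \<times> {..<2 ^ m}.
     indicator (cell_interval C m (fst p) (snd p)) u * (real (g p) / 2 ^ m))"

text \<open>The lower left corners of the cells whose intervals contain \<open>u\<close> increase with the level, so the
  supremum is the coordinate of the point to which these nested cells shrink.\<close>

definition limit_coord :: "(nat \<times> nat \<Rightarrow> nat) \<Rightarrow> (real \<Rightarrow> real \<Rightarrow> real) \<Rightarrow> real \<Rightarrow> real" where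
  "limit_coord g C u = (SUP m. cell_coord g C m u)"

lemma cell_coord_eq:
  assumes "copula C" "i < 2 ^ m" "j < 2 ^ m" "u \<in> cell_interval C m i j"
  shows "cell_coord g C m u = real (g (i, j)) / 2 ^ m"
proof -
  have "cell_coord g C m u =
      (\<Sum>p\<in>{..<2 ^ m} \<times> {..<2 ^ m}. if p = (i, j) then real (g p) / 2 ^ m else 0)"
    unfolding cell_coord_def
  proof (intro sum.cong refl)
    fix p :: "nat \<times> nat"
    assume "p \<in> {..<2 ^ m} \<times> {..<2 ^ m}"
    then have "u \<in> cell_interval C m (fst p) (snd p) \<longleftrightarrow> p = (i, j)"
      using cell_interval_partition(2)[OF assms(1) assms(2,3), of "fst p" "snd p" u] assms(4)
      by (auto simp: mem_Times_iff prod_eq_iff)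
    then show "indicator (cell_interval C m (fst p) (snd p)) u * (real (g p) / 2 ^ m) =
        (if p = (i, j) then real (g p) / 2 ^ m else 0)"
      by (simp add: indicator_def)
  qed
  also have "\<dots> = real (g (i, j)) / 2 ^ m"
    using assms(2,3) by (subst sum.delta) auto
  finally show ?thesis .
qed

lemma cell_coord_outside:
  assumes "copula C" "u \<notin> {0..<1}"
  shows "cell_coord g C m u = 0"
  unfolding cell_coord_def
proof (intro sum.neutral ballI)
  fix p :: "nat \<times> nat"
  assume "p \<in> {..<2 ^ m} \<times> {..<2 ^ m}"
  then have "u \<notin> cell_interval C m (fst p) (snd p)"
    using cell_interval_partition(1)[OF assms(1), of u m] assms(2) by (auto simp: mem_Times_iff)
  then show "indicator (cell_interval C m (fst p) (snd p)) u * (real (g p) / 2 ^ m) = 0"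
    by simp
qed

lemma cell_interval_ancestor:
  assumes "copula C" "i < 2 ^ (m + k)" "j < 2 ^ (m + k)" "u \<in> cell_interval C (m + k) i j"
  shows "u \<in> cell_interval C m (i div 2 ^ k) (j div 2 ^ k)"
  using assms(2-)
proof (induction k arbitrary: i j)
  case (Suc k)
  have lt: "i div 2 < 2 ^ (m + k)" "j div 2 < 2 ^ (m + k)"
    using Suc.prems by auto
  moreover have "u \<in> cell_interval C (m + k) (i div 2) (j div 2)"
    using Suc.prems(3) cell_interval_refine(1)[OF assms(1) lt, of u] by auto
  ultimately have "u \<in> cell_interval C m (i div 2 div 2 ^ k) (j div 2 div 2 ^ k)"
    by (rule Suc.IH)
  then show ?case
    by (simp add: div_mult2_eq)
qed simp

text \<open>The levels \<open>m\<close> and \<open>k\<close> may stand in either order. Both cells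
  of \<open>u\<close> are ancestors of its cell at level \<open>m + k\<close>, so comparing with
  that one avoids a case distinction and reduces the claim to rounding of the single number
  \<open>h\<close>.\<close>

lemma cell_coord_bounds:
  assumes "copula C" "g = fst \<or> g = snd" "i < 2 ^ m" "j < 2 ^ m" "u \<in> cell_interval C m i j"
  shows "cell_coord g C k u \<le> real (Suc (g (i, j))) / 2 ^ m"
proof -
  have "u \<in> {0..<1}"
    using cell_interval_partition(1)[OF assms(1)] assms(3-) by blast
  then obtain i' j' where ij': "i' < 2 ^ (m + k)" "j' < 2 ^ (m + k)" "u \<in> cell_interval C (m + k) i' j'"
    using cell_interval_partition(1)[OF assms(1)] by blast
  define h where "h = g (i', j')"
  have lt: "a div 2 ^ k < 2 ^ m" "a div 2 ^ m < 2 ^ k" if "a < 2 ^ (m + k)" for a :: nat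
    using that by (simp_all add: less_mult_imp_div_less power_add mult.commute)
  have "i' div 2 ^ k = i \<and> j' div 2 ^ k = j"
    using cell_interval_ancestor[OF assms(1) ij'] assms lt ij'
    by (intro cell_interval_partition(2)[OF assms(1)]) auto
  then have "g (i, j) = h div 2 ^ k"
    using assms(2) by (auto simp: h_def)
  moreover have "cell_coord g C k u = real (h div 2 ^ m) / 2 ^ k"
  proof -
    have "u \<in> cell_interval C k (i' div 2 ^ m) (j' div 2 ^ m)"
      using ij' by (intro cell_interval_ancestor[OF assms(1)]) (simp_all add: add.commute)
    then have "cell_coord g C k u = real (g (i' div 2 ^ m, j' div 2 ^ m)) / 2 ^ k"
      using assms(1) lt ij' by (intro cell_coord_eq) auto
    then show ?thesis
      using assms(2) by (auto simp: h_def)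
  qed
  moreover have "real (h div 2 ^ m) / 2 ^ k \<le> real h / 2 ^ (m + k)"
    using of_nat_div_le_of_nat[of h "2 ^ m", where 'a = real] by (simp add: power_add field_simps)
  moreover have "real h / 2 ^ (m + k) \<le> real (Suc (h div 2 ^ k)) / 2 ^ m"
  proof -
    have "h \<le> Suc (h div 2 ^ k) * 2 ^ k"
      using dividend_less_div_times[of "2 ^ k" h] by simp
    then have "real h \<le> real (Suc (h div 2 ^ k)) * 2 ^ k"
      by (metis of_nat_le_iff of_nat_mult of_nat_numeral of_nat_power)
    then show ?thesis
      by (simp add: power_add field_simps)
  qed
  ultimately show ?thesis
    by simp
qed

lemma cell_coord_le_1:
  assumes "copula C" "g = fst \<or> g = snd"
  shows "cell_coord g C k u \<le> 1"
proof (cases "u \<in> {0..<1}")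
  case True
  then have "u \<in> cell_interval C 0 0 0"
    using cell_interval_partition(1)[OF assms(1), of u 0] by simp
  with cell_coord_bounds[OF assms, of 0 0 0 u k] show ?thesis
    using assms(2) by auto
qed (simp add: cell_coord_outside[OF assms(1)])

lemma bdd_above_cell_coord:
  assumes "copula C" "g = fst \<or> g = snd"
  shows "bdd_above (range (\<lambda>m. cell_coord g C m u))"
  by (rule bdd_aboveI2[where M = 1]) (rule cell_coord_le_1[OF assms])

text \<open>The upper bound is not strict: corners increasing towards the far edge of the cell can
  have their supremum on it. A limit point equal to the left edge of a cell may therefore also come
  from the cell before it.\<close>

lemma limit_coord_bounds:
  assumes "copula C" "g = fst \<or> g = snd" "i < 2 ^ m" "j < 2 ^ m" "u \<in> cell_interval C m i j"
  shows "real (g (i, j)) / 2 ^ m \<le> limit_coord g C u"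
    and "limit_coord g C u \<le> real (Suc (g (i, j))) / 2 ^ m"
proof -
  show "real (g (i, j)) / 2 ^ m \<le> limit_coord g C u"
    unfolding limit_coord_def cell_coord_eq[OF assms(1,3-), of g, symmetric]
    by (rule cSUP_upper[OF UNIV_I bdd_above_cell_coord[OF assms(1,2)]])
  show "limit_coord g C u \<le> real (Suc (g (i, j))) / 2 ^ m"
    unfolding limit_coord_def by (rule cSUP_least) (simp_all add: cell_coord_bounds[OF assms] del: of_nat_Suc)
qed

lemma limit_coord_unit:
  assumes "copula C" "g = fst \<or> g = snd"
  shows "limit_coord g C u \<in> {0..1}"
proof -
  have "0 \<le> cell_coord g C 0 u"
    by (simp add: cell_coord_def sum_nonneg)
  also have "\<dots> \<le> limit_coord g C u"
    unfolding limit_coord_def by (rule cSUP_upper[OF UNIV_I bdd_above_cell_coord[OF assms]])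
  finally show ?thesis
    unfolding limit_coord_def using cell_coord_le_1[OF assms] by (auto intro: cSUP_least)
qed

lemma borel_measurable_limit_coord:
  assumes "copula C" "g = fst \<or> g = snd"
  shows "limit_coord g C \<in> borel_measurable borel"
proof -
  have "(\<lambda>u. SUP m\<in>UNIV. cell_coord g C m u) \<in> borel_measurable borel"
  proof (rule borel_measurable_cSUP)
    show "cell_coord g C m \<in> borel_measurable borel" for m
      unfolding cell_coord_def cell_interval_def by measurable
  qed (use bdd_above_cell_coord[OF assms] in auto)
  then show ?thesis
    by (simp add: limit_coord_def[abs_def])
qed

section \<open>The distribution of the limit point\<close>

lemma fmeasurable_Ico: "{a..<b :: real} \<in> fmeasurable lborel"
  by (intro fmeasurableI emeasure_bounded_finite) auto

lemma measure_cell_union: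
  assumes "copula C" "k \<le> 2 ^ m" "l \<le> 2 ^ m"
  shows "measure lborel (\<Union>p\<in>{..<k} \<times> {..<l}. cell_interval C m (fst p) (snd p)) =
    C (real k / 2 ^ m) (real l / 2 ^ m)"
proof -
  have "measure lborel (\<Union>p\<in>{..<k} \<times> {..<l}. cell_interval C m (fst p) (snd p)) =
      (\<Sum>p\<in>{..<k} \<times> {..<l}. measure lborel (cell_interval C m (fst p) (snd p)))"
  proof (rule measure_finite_Union)
    show "disjoint_family_on (\<lambda>p. cell_interval C m (fst p) (snd p)) ({..<k} \<times> {..<l})"
      unfolding disjoint_family_on_def
    proof (intro ballI impI)
      fix p q
      assume "p \<in> {..<k} \<times> {..<l}" "q \<in> {..<k} \<times> {..<l}" and ne: "p \<noteq> q"
      then have "fst p < 2 ^ m" "snd p < 2 ^ m" "fst q < 2 ^ m" "snd q < 2 ^ m"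
        using assms(2,3) by auto
      with cell_interval_partition(2)[OF assms(1) this] ne
      show "cell_interval C m (fst p) (snd p) \<inter> cell_interval C m (fst q) (snd q) = {}"
        by (auto simp: prod_eq_iff)
    qed
  qed (use fmeasurableD2[OF fmeasurable_Ico] in \<open>auto simp: cell_interval_def\<close>)
  also have "\<dots> = (\<Sum>p\<in>{..<k} \<times> {..<l}. cell_vol C m (fst p) (snd p))"
    using assms by (intro sum.cong refl) (auto simp: cell_interval_def cell_vol_nonneg)
  also have "\<dots> = C (real k / 2 ^ m) (real l / 2 ^ m)"
    using cell_vol_telescope[OF assms] by (simp add: sum.cartesian_product case_prod_unfold)
  finally show ?thesis .
qed

lemma dyadic_approx:
  fixes x :: real
  assumes "x \<in> {0..1}"
  obtains k k' :: nat where "k \<le> 2 ^ m" "k' \<le> 2 ^ m" "real k / 2 ^ m \<le> x" "x \<le> real k' / 2 ^ m"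
    "x - real k / 2 ^ m \<le> 1 / 2 ^ m" "real k' / 2 ^ m - x \<le> 1 / 2 ^ m"
    "\<forall>i<2 ^ m. real i / 2 ^ m \<le> x \<longrightarrow> i < k'"
proof -
  define k where "k = nat \<lfloor>x * 2 ^ m\<rfloor>"
  have x: "0 \<le> x * 2 ^ m" "x * 2 ^ m \<le> 2 ^ m"
    using assms by auto
  have k: "real k \<le> x * 2 ^ m" "x * 2 ^ m < real k + 1"
    using x unfolding k_def by (simp_all add: of_nat_nat floor_le_iff)
  have "real k \<le> 2 ^ m"
    using k(1) x(2) by (rule order_trans)
  then have k2: "k \<le> 2 ^ m"
    by simp
  \<comment> \<open>One more than the floor, not the ceiling: a cell whose left edge is exactly
    \<open>x\<close> has to be counted. The cap keeps \<open>k'\<close> on the grid when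
    \<open>x\<close> is 1.\<close>
  define k' where "k' = min (Suc k) (2 ^ m)"
  have k': "real k' = min (real k + 1) (2 ^ m)"
    by (simp add: k'_def of_nat_min add.commute)
  show ?thesis
  proof (rule that[of k k'])
    show "\<forall>i<2 ^ m. real i / 2 ^ m \<le> x \<longrightarrow> i < k'"
    proof (intro allI impI)
      fix i :: nat
      assume that: "i < 2 ^ m" "real i / 2 ^ m \<le> x"
      have "real i < real (Suc k)"
        using order_le_less_trans[OF _ k(2), of "real i"] that(2) by (simp add: divide_le_eq)
      then show "i < k'"
        using that(1) by (simp add: k'_def)
    qed
    have "x * 2 ^ m / 2 ^ m \<le> real k' / 2 ^ m" "real k' / 2 ^ m \<le> (x * 2 ^ m + 1) / 2 ^ m"
      "real k / 2 ^ m \<le> x * 2 ^ m / 2 ^ m" "x * 2 ^ m / 2 ^ m \<le> (real k + 1) / 2 ^ m"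
      by (rule divide_right_mono; use k x in \<open>simp add: k'\<close>)+
    then show "x \<le> real k' / 2 ^ m" "real k' / 2 ^ m - x \<le> 1 / 2 ^ m"
      "real k / 2 ^ m \<le> x" "x - real k / 2 ^ m \<le> 1 / 2 ^ m"
      by (simp_all add: add_divide_distrib)
  qed (use k2 in \<open>simp_all add: k'_def\<close>)
qed

text \<open>The cells wholly to the lower left of the point (x, y) give a subset of the set in
  question, the cells whose lower left corner is at most (x, y) a superset. The lengths of both
  unions are values of \<open>C\<close> at grid points within \<open>1 / 2 ^ m\<close> in each
  coordinate, hence within twice that of \<open>C x y\<close>.\<close>

lemma measure_limit_coord:
  assumes C: "copula C" and x: "x \<in> {0..1}" and y: "y \<in> {0..1}"
  shows "measure lborel {u\<in>{0..<1}. limit_coord fst C u \<le> x \<and> limit_coord snd C u \<le> y} = C x y"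
    (is "measure lborel ?E = _")
proof -
  have [measurable]: "limit_coord fst C \<in> borel_measurable borel" "limit_coord snd C \<in> borel_measurable borel"
    using C by (auto intro: borel_measurable_limit_coord)
  have E: "?E \<in> sets lborel"
    by measurable
  have E_fin: "?E \<in> fmeasurable lborel"
    by (rule fmeasurableI2[OF fmeasurable_Ico[of 0 1]]) (use E in auto)
  have close: "\<bar>measure lborel ?E - C x y\<bar> \<le> 2 * (1 / 2) ^ m" for m
  proof -
    obtain k k' where k: "k \<le> 2 ^ m" "k' \<le> 2 ^ m" "real k / 2 ^ m \<le> x" "x \<le> real k' / 2 ^ m"
      "x - real k / 2 ^ m \<le> 1 / 2 ^ m" "real k' / 2 ^ m - x \<le> 1 / 2 ^ m"
      "\<forall>i<2 ^ m. real i / 2 ^ m \<le> x \<longrightarrow> i < k'"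
      using x by (rule dyadic_approx[where m = m])
    obtain l l' where l: "l \<le> 2 ^ m" "l' \<le> 2 ^ m" "real l / 2 ^ m \<le> y" "y \<le> real l' / 2 ^ m"
      "y - real l / 2 ^ m \<le> 1 / 2 ^ m" "real l' / 2 ^ m - y \<le> 1 / 2 ^ m"
      "\<forall>i<2 ^ m. real i / 2 ^ m \<le> y \<longrightarrow> i < l'"
      using y by (rule dyadic_approx[where m = m])
    define G where "G k l = (\<Union>p\<in>{..<k} \<times> {..<l}. cell_interval C m (fst p) (snd p))" for k l
    have G: "G k l \<in> fmeasurable lborel" for k l
      unfolding G_def cell_interval_def by (intro fmeasurable.finite_UN fmeasurable_Ico) auto
    have unit: "real i / 2 ^ m \<le> 1" if "i \<le> 2 ^ m" for i
      using of_nat_mono[OF that, where 'a = real] by (simp add: divide_le_eq)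
    have "G k l \<subseteq> ?E"
    proof
      fix u assume "u \<in> G k l"
      then obtain i j where ij: "i < k" "j < l" "u \<in> cell_interval C m i j"
        by (auto simp: G_def)
      then have lt: "i < 2 ^ m" "j < 2 ^ m"
        using k(1) l(1) by auto
      have "real (Suc i) / 2 ^ m \<le> real k / 2 ^ m" "real (Suc j) / 2 ^ m \<le> real l / 2 ^ m"
        using ij by (auto intro!: divide_right_mono simp del: of_nat_Suc)
      moreover have "u \<in> {0..<1}"
        using cell_interval_partition(1)[OF C] lt ij by blast
      ultimately show "u \<in> ?E"
        using limit_coord_bounds(2)[OF C _ lt ij(3), of fst] limit_coord_bounds(2)[OF C _ lt ij(3), of snd]
          k(3) l(3) by simp
    qed
    then have "measure lborel (G k l) \<le> measure lborel ?E"
      by (intro measure_mono_fmeasurable E_fin fmeasurableD G)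
    then have lower: "C (real k / 2 ^ m) (real l / 2 ^ m) \<le> measure lborel ?E"
      by (simp add: G_def measure_cell_union[OF C k(1) l(1)])
    have "?E \<subseteq> G k' l'"
    proof
      fix u assume u: "u \<in> ?E"
      then obtain i j where ij: "i < 2 ^ m" "j < 2 ^ m" "u \<in> cell_interval C m i j"
        using cell_interval_partition(1)[OF C, of u m] by auto
      have "i < k'" "j < l'"
        using limit_coord_bounds(1)[OF C _ ij, of fst] limit_coord_bounds(1)[OF C _ ij, of snd] u
        ij k(7) l(7) by auto
      with ij show "u \<in> G k' l'"
        by (auto simp: G_def)
    qed
    then have "measure lborel ?E \<le> measure lborel (G k' l')"
      by (intro measure_mono_fmeasurable E G)
    then have upper: "measure lborel ?E \<le> C (real k' / 2 ^ m) (real l' / 2 ^ m)"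
      by (simp add: G_def measure_cell_union[OF C k(2) l(2)])
    have "C x y \<le> C (real k / 2 ^ m) (real l / 2 ^ m) + (x - real k / 2 ^ m) + (y - real l / 2 ^ m)"
      using x y k l by (intro copula_lipschitz[OF C]) auto
    moreover have "C (real k' / 2 ^ m) (real l' / 2 ^ m) \<le> C x y + (real k' / 2 ^ m - x) + (real l' / 2 ^ m - y)"
      using x y k l unit[of k'] unit[of l'] by (intro copula_lipschitz[OF C]) auto
    ultimately show ?thesis
      using lower upper k l by (simp add: power_one_over)
  qed
  have "(\<lambda>m. 2 * (1 / 2 :: real) ^ m) \<longlonglongrightarrow> 2 * 0"
    by (intro tendsto_mult tendsto_const LIMSEQ_power_zero) simp
  then have "\<bar>measure lborel ?E - C x y\<bar> \<le> 2 * 0"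
    by (rule LIMSEQ_le_const) (use close in blast)
  then show ?thesis
    by simp
qed

lemma copula_measure_exists:
  assumes C: "copula C"
  obtains \<mu> where "sets \<mu> = sets (restrict_space borel unit_square)" "prob_space \<mu>"
    "\<And>x y. x \<in> {0..1} \<Longrightarrow> y \<in> {0..1} \<Longrightarrow> measure \<mu> ({0..x} \<times> {0..y}) = C x y"
proof -
  define M where "M = restrict_space lborel {0..<1 :: real}"
  define \<phi> where "\<phi> u = (limit_coord fst C u, limit_coord snd C u)" for u
  define \<mu> where "\<mu> = distr M (restrict_space borel unit_square) \<phi>"
  have [measurable]: "limit_coord fst C \<in> borel_measurable borel" "limit_coord snd C \<in> borel_measurable borel"
    using C by (auto intro: borel_measurable_limit_coord)
  have sp: "space M = {0..<1}"
    by (simp add: M_def space_restrict_space)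
  interpret M: prob_space M
    by (rule prob_spaceI) (simp add: M_def space_restrict_space emeasure_restrict_space)
  have "\<phi> \<in> M \<rightarrow>\<^sub>M borel"
    unfolding \<phi>_def M_def by (intro measurable_restrict_space1) measurable
  then have \<phi>: "\<phi> \<in> M \<rightarrow>\<^sub>M restrict_space borel unit_square"
    using limit_coord_unit[OF C, of fst] limit_coord_unit[OF C, of snd]
    by (intro measurable_restrict_space2) (simp_all add: \<phi>_def mem_Times_iff)
  show ?thesis
  proof (rule that[of \<mu>])
    show "sets \<mu> = sets (restrict_space borel unit_square)"
      by (simp add: \<mu>_def)
    show "prob_space \<mu>"
      unfolding \<mu>_def by (rule M.prob_space_distr[OF \<phi>])
    fix x y :: real
    assume xy: "x \<in> {0..1}" "y \<in> {0..1}"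
    have "{0..x} \<times> {0..y} \<in> sets (restrict_space borel unit_square)"
      using xy by (intro sets_restrict_space_iff[THEN iffD2]) (auto intro!: borel_closed closed_Times)
    then have "measure \<mu> ({0..x} \<times> {0..y}) = measure M (\<phi> -` ({0..x} \<times> {0..y}) \<inter> space M)"
      unfolding \<mu>_def by (rule measure_distr[OF \<phi>])
    also have "\<dots> = measure lborel (\<phi> -` ({0..x} \<times> {0..y}) \<inter> space M)"
      unfolding M_def by (intro measure_restrict_space) (auto simp: space_restrict_space)
    also have "\<phi> -` ({0..x} \<times> {0..y}) \<inter> space M =
        {u\<in>{0..<1}. limit_coord fst C u \<le> x \<and> limit_coord snd C u \<le> y}"
      using limit_coord_unit[OF C, of fst] limit_coord_unit[OF C, of snd] by (auto simp: \<phi>_def sp)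
    also have "measure lborel \<dots> = C x y"
      by (rule measure_limit_coord[OF C xy])
    finally show "measure \<mu> ({0..x} \<times> {0..y}) = C x y" .
  qed
qed

section \<open>Uniqueness and marginals\<close>


lemma sets_unit_square_iff:
  "A \<in> sets (restrict_space borel unit_square) \<longleftrightarrow> A \<in> sets borel \<and> A \<subseteq> unit_square"
proof -
  have "unit_square \<in> sets borel"
    by (intro borel_closed closed_Times closed_real_atLeastAtMost)
  then show ?thesis
    by (simp add: sets_restrict_space_iff conj_commute)
qed

lemma space_unit_square:
  "sets \<mu> = sets (restrict_space borel unit_square) \<Longrightarrow> space \<mu> = unit_square"
  using sets_eq_imp_space_eq[of \<mu> "restrict_space borel unit_square"] by (simp add: space_restrict_space)

text \<open>Lower left quadrants form an intersection-stable generator of the Borel sets of the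
  plane, so both measures are transported there by \<open>id\<close>. A quadrant meets the unit
  square in a rectangle with corner at the origin or not at all.\<close>

lemma unit_square_measure_unique:
  assumes \<mu>: "sets \<mu> = sets (restrict_space borel unit_square)" "prob_space \<mu>"
    and \<nu>: "sets \<nu> = sets (restrict_space borel unit_square)" "prob_space \<nu>"
    and eq: "\<And>x y. x \<in> {0..1} \<Longrightarrow> y \<in> {0..1} \<Longrightarrow> measure \<mu> ({0..x} \<times> {0..y}) = measure \<nu> ({0..x} \<times> {0..y})"
  shows "\<mu> = \<nu>"
proof -
  interpret \<mu>: prob_space \<mu> by fact
  interpret \<nu>: prob_space \<nu> by fact
  have id: "id \<in> M \<rightarrow>\<^sub>M borel" if "sets M = sets (restrict_space borel unit_square)"
    for M :: "(real \<times> real) measure"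
    unfolding measurable_cong_sets[OF that refl] by (rule measurable_restrict_space1) simp
  have em: "emeasure (distr M borel id) A = emeasure M (A \<inter> unit_square)"
    if "sets M = sets (restrict_space borel unit_square)" "A \<in> sets borel" for M A
    using that by (simp add: emeasure_distr[OF id[OF that(1)]] space_unit_square)
  have "distr \<mu> borel id = distr \<nu> borel id"
  proof (rule measure_eqI_generator_eq)
    let ?E = "range (\<lambda>a :: real \<times> real. {..a})"
    show "Int_stable ?E"
    proof (rule Int_stableI_image)
      show "\<exists>k\<in>UNIV. {..i} \<inter> {..j} = {..k}" for i j :: "real \<times> real"
        by (rule bexI[of _ "inf i j"]) (auto simp only: set_eq_iff Int_iff atMost_iff le_inf_iff UNIV_I)
    qed
    show "sets (distr \<mu> borel id) = sigma_sets UNIV ?E" "sets (distr \<nu> borel id) = sigma_sets UNIV ?E"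
      by (simp_all add: borel_eq_atMost)
    show "range (\<lambda>n :: nat. {..(real n, real n)}) \<subseteq> ?E"
      by auto
    show "(\<Union>n :: nat. {..(real n, real n)}) = UNIV"
    proof (intro equalityI subsetI UNIV_I)
      fix z :: "real \<times> real"
      obtain n :: nat where "max (fst z) (snd z) \<le> real n"
        using real_arch_simple by blast
      then show "z \<in> (\<Union>n :: nat. {..(real n, real n)})"
        by (auto simp: less_eq_prod_def)
    qed
    show "emeasure (distr \<mu> borel id) {..(real n, real n)} \<noteq> \<infinity>" for n :: nat
      by (simp add: em[OF \<mu>(1)])
    show "emeasure (distr \<mu> borel id) X = emeasure (distr \<nu> borel id) X" if X: "X \<in> ?E" for X
    proof -
      obtain x y where "X = {..(x, y)}"
        using X by auto
      then have int: "X \<inter> unit_square = {0..min x 1} \<times> {0..min y 1}"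
        by (auto simp: less_eq_prod_def)
      have "measure \<mu> (X \<inter> unit_square) = measure \<nu> (X \<inter> unit_square)"
      proof (cases "0 \<le> x \<and> 0 \<le> y")
        case True
        then show ?thesis
          unfolding int by (intro eq) auto
      next
        case False
        then have "X \<inter> unit_square = {}"
          unfolding int by auto
        then show ?thesis
          by simp
      qed
      moreover have "X \<in> sets borel"
        using X by auto
      ultimately show ?thesis
        by (simp add: em \<mu> \<nu> \<mu>.emeasure_eq_measure \<nu>.emeasure_eq_measure)
    qed
  qed simp
  then show ?thesis
    using em[OF \<mu>(1)] em[OF \<nu>(1)] \<mu>(1) \<nu>(1)
    by (intro measure_eqI) (auto simp: sets_unit_square_iff Int_absorb2, metis Int_absorb2)
qed

lemma copula_measure_eq:
  assumes "sets \<mu> = sets (restrict_space borel unit_square)" "prob_space \<mu>"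
    and "\<And>x y. x \<in> {0..1} \<Longrightarrow> y \<in> {0..1} \<Longrightarrow> measure \<mu> ({0..x} \<times> {0..y}) = C x y"
  shows "copula_measure C = \<mu>"
  unfolding copula_measure_def
proof (rule the_equality)
  fix \<nu>
  assume "sets \<nu> = sets (restrict_space borel unit_square) \<and> prob_space \<nu> \<and>
    (\<forall>x\<in>{0..1}. \<forall>y\<in>{0..1}. measure \<nu> ({0..x} \<times> {0..y}) = C x y)"
  with assms show "\<nu> = \<mu>"
    by (intro unit_square_measure_unique) simp_all
qed (use assms in simp)

lemma copula_measure:
  assumes "copula C"
  shows "sets (copula_measure C) = sets (restrict_space borel unit_square)"
    and "prob_space (copula_measure C)"
    and "\<And>x y. x \<in> {0..1} \<Longrightarrow> y \<in> {0..1} \<Longrightarrow> measure (copula_measure C) ({0..x} \<times> {0..y}) = C x y"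
proof -
  obtain \<mu> where \<mu>: "sets \<mu> = sets (restrict_space borel unit_square)" "prob_space \<mu>"
    "\<And>x y. x \<in> {0..1} \<Longrightarrow> y \<in> {0..1} \<Longrightarrow> measure \<mu> ({0..x} \<times> {0..y}) = C x y"
    using copula_measure_exists[OF assms] by blast
  have "copula_measure C = \<mu>"
    by (rule copula_measure_eq[OF \<mu>])
  with \<mu> show "sets (copula_measure C) = sets (restrict_space borel unit_square)"
    and "prob_space (copula_measure C)"
    and "\<And>x y. x \<in> {0..1} \<Longrightarrow> y \<in> {0..1} \<Longrightarrow> measure (copula_measure C) ({0..x} \<times> {0..y}) = C x y"
    by simp_all
qed

text \<open>The values on the lower and left edges vanish because the marginals give no mass to 0.
  The rectangle inequality is monotonicity: \<open>?A\<close> and \<open>?B\<close> overlap in the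
  small rectangle, and their L-shaped union lies inside the large one.\<close>

lemma copula_of_measure:
  assumes \<mu>: "sets \<mu> = sets (restrict_space borel unit_square)" "prob_space \<mu>"
    and fst: "\<And>x. x \<in> {0..1} \<Longrightarrow> measure \<mu> ({0..x} \<times> {0..1}) = x"
    and snd: "\<And>y. y \<in> {0..1} \<Longrightarrow> measure \<mu> ({0..1} \<times> {0..y}) = y"
  shows "copula (\<lambda>x y. measure \<mu> ({0..x} \<times> {0..y}))"
proof -
  interpret prob_space \<mu> by fact
  have S: "{0..x} \<times> {0..y} \<in> sets \<mu>" if "x \<in> {0..1}" "y \<in> {0..1}" for x y :: real
    using that by (auto simp: \<mu> sets_unit_square_iff borel_Times)
  show ?thesis
    unfolding copula_def
  proof (intro conjI ballI impI)
    fix t :: real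
    assume t: "t \<in> {0..1}"
    have "measure \<mu> ({0..t} \<times> {0..0}) \<le> measure \<mu> ({0..1} \<times> {0..0})"
      using t by (intro finite_measure_mono S) auto
    then show "measure \<mu> ({0..t} \<times> {0..0}) = 0"
      using snd[of 0] by (simp add: order_antisym)
    have "measure \<mu> ({0..0} \<times> {0..t}) \<le> measure \<mu> ({0..0} \<times> {0..1})"
      using t by (intro finite_measure_mono S) auto
    then show "measure \<mu> ({0..0} \<times> {0..t}) = 0"
      using fst[of 0] by (simp add: order_antisym)
  next
    fix x1 x2 y1 y2 :: real
    assume x: "x1 \<in> {0..1}" "x2 \<in> {0..1}" and y: "y1 \<in> {0..1}" "y2 \<in> {0..1}"
      and le: "x1 \<le> x2" "y1 \<le> y2"
    let ?A = "{0..x2} \<times> {0..y1}" and ?B = "{0..x1} \<times> {0..y2}"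
    have "measure \<mu> (?A \<union> ?B) = measure \<mu> ?A + measure \<mu> (?B - ?A)"
      using x y by (intro finite_measure_Union') (auto intro: S)
    also have "measure \<mu> (?B - ?A) = measure \<mu> ?B - measure \<mu> (?B \<inter> ?A)"
      using x y by (intro finite_measure_Diff') (auto intro: S)
    also have "?B \<inter> ?A = {0..x1} \<times> {0..y1}"
      using le by auto
    finally have "measure \<mu> (?A \<union> ?B) = measure \<mu> ?A + (measure \<mu> ?B - measure \<mu> ({0..x1} \<times> {0..y1}))" .
    moreover have "measure \<mu> (?A \<union> ?B) \<le> measure \<mu> ({0..x2} \<times> {0..y2})"
      using x y le by (intro finite_measure_mono S) auto
    ultimately show "0 \<le> measure \<mu> ({0..x2} \<times> {0..y2}) - measure \<mu> ({0..x2} \<times> {0..y1}) -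
        measure \<mu> ({0..x1} \<times> {0..y2}) + measure \<mu> ({0..x1} \<times> {0..y1})"
      by simp
  qed (simp_all add: fst snd)
qed

text \<open>The hypothesis speaks of closed intervals. The end point \<open>c\<close> has no mass
  because \<open>{0..<c}\<close> already contains \<open>{0..c - e}\<close>, of mass
  \<open>c - e\<close>, for every small positive \<open>e\<close>.\<close>

lemma uniform_measure_Ico:
  fixes N :: "real measure"
  assumes "prob_space N" and N: "sets N = sets borel"
    and cdf: "\<And>x. x \<in> {0..1} \<Longrightarrow> measure N {0..x} = x"
    and ab: "0 \<le> a" "a \<le> b" "b \<le> 1"
  shows "measure N {a..<b} = b - a"
proof -
  interpret prob_space N by fact
  have *: "measure N {0..<c} = c" if c: "c \<in> {0..1}" for c
  proof (rule antisym)
    have "measure N {0..<c} \<le> measure N {0..c}"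
      by (intro finite_measure_mono) (auto simp: N)
    then show "measure N {0..<c} \<le> c"
      using cdf[OF c] by simp
    show "c \<le> measure N {0..<c}"
    proof (rule field_le_epsilon)
      fix e :: real
      assume e: "0 < e"
      show "c \<le> measure N {0..<c} + e"
      proof (cases "e \<le> c")
        case True
        have "measure N {0..c - e} \<le> measure N {0..<c}"
          using e by (intro finite_measure_mono) (auto simp: N)
        then show ?thesis
          using cdf[of "c - e"] c e True by simp
      next
        case False
        then show ?thesis
          using measure_nonneg[of N "{0..<c}"] by linarith
      qed
    qed
  qed
  have "{a..<b} = {0..<b} - {0..<a}"
    using ab by auto
  then have "measure N {a..<b} = measure N {0..<b} - measure N {0..<a}"
    using ab finite_measure_Diff[of "{0..<b}" "{0..<a}"] by (simp add: N)
  then show ?thesis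
    using ab * by simp
qed

lemma copula_measure_strip:
  assumes C: "copula C" and ab: "0 \<le> a" "a \<le> b" "b \<le> 1"
  shows "measure (copula_measure C) ({a..<b} \<times> {0..<1}) = b - a"
    and "measure (copula_measure C) ({0..<1} \<times> {a..<b}) = b - a"
proof -
  define \<mu> where "\<mu> = copula_measure C"
  note \<mu> = copula_measure[OF C, folded \<mu>_def]
  interpret prob_space \<mu> by (rule \<mu>)
  have proj: "fst \<in> \<mu> \<rightarrow>\<^sub>M borel" "snd \<in> \<mu> \<rightarrow>\<^sub>M borel"
    unfolding measurable_cong_sets[OF \<mu>(1) refl]
    by (intro measurable_restrict_space1; simp add: borel_prod[symmetric])+
  have vimage: "fst -` A \<inter> space \<mu> = A \<times> {0..1}" "snd -` A \<inter> space \<mu> = {0..1} \<times> A"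
    if "A \<subseteq> {0..1}" for A
    using that by (auto simp: space_unit_square[OF \<mu>(1)])
  have marginal: "measure \<mu> ({c..<d} \<times> {0..1}) = d - c" "measure \<mu> ({0..1} \<times> {c..<d}) = d - c"
    if cd: "0 \<le> c" "c \<le> d" "d \<le> 1" for c d
  proof -
    have sub: "{c..<d} \<subseteq> {0..1}"
      using cd by auto
    have "measure (distr \<mu> borel fst) {c..<d} = d - c"
      by (rule uniform_measure_Ico)
        (use C cd in \<open>simp_all add: prob_space_distr proj measure_distr vimage \<mu>(3) copula_boundary\<close>)
    then show "measure \<mu> ({c..<d} \<times> {0..1}) = d - c"
      by (simp add: measure_distr proj vimage[OF sub])
    have "measure (distr \<mu> borel snd) {c..<d} = d - c"
      by (rule uniform_measure_Ico)
        (use C cd in \<open>simp_all add: prob_space_distr proj measure_distr vimage \<mu>(3) copula_boundary\<close>)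
    then show "measure \<mu> ({0..1} \<times> {c..<d}) = d - c"
      by (simp add: measure_distr proj vimage[OF sub])
  qed
  \<comment> \<open>Removing the edge where a coordinate equals 1 is intersecting with a set of full
    measure.\<close>
  have inter: "measure \<mu> (A \<inter> B) = measure \<mu> A"
    if "A \<in> sets \<mu>" "B \<in> sets \<mu>" "measure \<mu> B = 1" for A B
    using that prob_eq_1[of B] by (intro measure_eq_AE) auto
  have S: "A \<times> B \<in> sets \<mu>" if "A \<in> sets borel" "B \<in> sets borel" "A \<subseteq> {0..1}" "B \<subseteq> {0..1}" for A B
    using that by (auto simp: \<mu>(1) sets_unit_square_iff intro: borel_Times)
  have "{a..<b} \<times> {0..<1 :: real} = ({a..<b} \<times> {0..1}) \<inter> ({0..1} \<times> {0..<1})"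
    using ab by auto
  then show "measure (copula_measure C) ({a..<b} \<times> {0..<1}) = b - a"
    using ab marginal[of a b] marginal[of 0 1] by (simp only: \<mu>_def[symmetric]) (subst inter; (intro S)?; auto)
  have "{0..<1 :: real} \<times> {a..<b} = ({0..1} \<times> {a..<b}) \<inter> ({0..<1} \<times> {0..1})"
    using ab by auto
  then show "measure (copula_measure C) ({0..<1} \<times> {a..<b}) = b - a"
    using ab marginal[of a b] marginal[of 0 1] by (simp only: \<mu>_def[symmetric]) (subst inter; (intro S)?; auto)
qed

section \<open>Integrals of grid step functions and equipartition shuffles\<close>


definition grid_interval :: "nat \<Rightarrow> nat \<Rightarrow> real set" where
  "grid_interval n i = {(real i - 1) / real n..<real i / real n}"

lemma sum_indicator_grid_interval:
  assumes "n \<ge> 1"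
  shows "(\<Sum>i=1..n. indicator (grid_interval n i) x) = (indicator {0..<1} x :: real)"
proof -
  have "(\<Sum>i=1..m. indicator (grid_interval n i) x) = (indicator {0..<real m / real n} x :: real)" for m
  proof (induction m)
    case (Suc m)
    have "real m / real n \<le> real (Suc m) / real n"
      by (simp add: divide_right_mono)
    then have "indicator {0..<real (Suc m) / real n} x =
        (indicator {0..<real m / real n} x + indicator (grid_interval n (Suc m)) x :: real)"
      by (auto simp: grid_interval_def indicator_def intro: order_trans[of 0 "real m / real n"])
    with Suc show ?case
      by simp
  qed simp
  from this[of n] show ?thesis
    using assms by simp
qed

lemma grid_interval_in_unit:
  assumes "i \<in> {1..n}"
  shows "grid_interval n i \<subseteq> {0..<1}" "grid_interval n i \<in> sets borel"
proof -
  have "0 \<le> (real i - 1) / real n" "real i / real n \<le> 1"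
    using assms by auto
  then show "grid_interval n i \<subseteq> {0..<1}"
    by (auto simp: grid_interval_def intro: order_trans less_le_trans)
qed (simp add: grid_interval_def)

lemma product_in_unit_square:
  assumes "sets \<mu> = sets (restrict_space borel unit_square)"
    and "A \<in> sets borel" "B \<in> sets borel" "A \<subseteq> {0..<1}" "B \<subseteq> {0..<1}"
  shows "A \<times> B \<in> sets \<mu>"
proof -
  have "A \<times> B \<subseteq> unit_square"
    using assms(4,5) by force
  then show ?thesis
    using assms(1-3) by (auto simp: sets_unit_square_iff borel_Times)
qed

text \<open>The indicator of the domain is a product of two sums of grid indicators. Inserting it
  replaces \<open>f\<close> by a constant on each cell and turns the integrand into a finite
  combination of indicators.\<close>

lemma integral_step_function:
  assumes n: "n \<ge> 1" and \<mu>: "sets \<mu> = sets (restrict_space borel unit_square)" "prob_space \<mu>"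
    and f: "\<And>i j x y. i \<in> {1..n} \<Longrightarrow> j \<in> {1..n} \<Longrightarrow> x \<in> grid_interval n i \<Longrightarrow>
      y \<in> grid_interval n j \<Longrightarrow> f (x, y) = a i j"
  shows "(LINT z:{0..<1} \<times> {0..<1}|\<mu>. f z) =
    (\<Sum>i=1..n. \<Sum>j=1..n. measure \<mu> (grid_interval n i \<times> grid_interval n j) * a i j)"
proof -
  interpret prob_space \<mu> by fact
  let ?Q = "\<lambda>i j. grid_interval n i \<times> grid_interval n j"
  have Q: "?Q i j \<in> sets \<mu>" if "i \<in> {1..n}" "j \<in> {1..n}" for i j
    using that grid_interval_in_unit by (intro product_in_unit_square \<mu>(1)) auto
  have "indicator ({0..<1} \<times> {0..<1}) z *\<^sub>R f z = (\<Sum>i=1..n. \<Sum>j=1..n. indicator (?Q i j) z *\<^sub>R a i j)" for z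
  proof -
    have "indicator ({0..<1} \<times> {0..<1}) z = (\<Sum>i=1..n. \<Sum>j=1..n. indicator (?Q i j) z :: real)"
      by (simp only: indicator_times sum_product[symmetric] sum_indicator_grid_interval[OF n])
    then have "indicator ({0..<1} \<times> {0..<1}) z *\<^sub>R f z = (\<Sum>i=1..n. \<Sum>j=1..n. indicator (?Q i j) z * f z)"
      by (simp add: sum_distrib_right)
    also have "\<dots> = (\<Sum>i=1..n. \<Sum>j=1..n. indicator (?Q i j) z *\<^sub>R a i j)"
      using f[of _ _ "fst z" "snd z"] by (intro sum.cong refl) (auto simp: indicator_def)
    finally show ?thesis .
  qed
  then have "(LINT z:{0..<1} \<times> {0..<1}|\<mu>. f z) =
      (LINT z|\<mu>. (\<Sum>i=1..n. \<Sum>j=1..n. indicator (?Q i j) z *\<^sub>R a i j))"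
    by (simp only: set_lebesgue_integral_def)
  also have "\<dots> = (\<Sum>i=1..n. LINT z|\<mu>. (\<Sum>j=1..n. indicator (?Q i j) z *\<^sub>R a i j))"
    using Q by (intro Bochner_Integration.integral_sum Bochner_Integration.integrable_sum integrable_scaleR_left)
      (simp_all add: less_top[symmetric])
  also have "\<dots> = (\<Sum>i=1..n. \<Sum>j=1..n. LINT z|\<mu>. indicator (?Q i j) z *\<^sub>R a i j)"
    using Q by (intro sum.cong refl Bochner_Integration.integral_sum integrable_scaleR_left)
      (simp_all add: less_top[symmetric])
  also have "\<dots> = (\<Sum>i=1..n. \<Sum>j=1..n. measure \<mu> (?Q i j) * a i j)"
  proof (intro sum.cong refl)
    fix i j assume "i \<in> {1..n}" "j \<in> {1..n}"
    then have "?Q i j \<in> sets \<mu>"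
      by (rule Q)
    then show "(LINT z|\<mu>. indicator (?Q i j) z *\<^sub>R a i j) = measure \<mu> (?Q i j) * a i j"
      by (simp add: sets.Int_space_eq2)
  qed
  finally show ?thesis .
qed

text \<open>Finite additivity, obtained by integrating the indicator identity for the grid instead
  of by decomposing the strip into disjoint sets.\<close>

lemma sum_measure_grid:
  assumes n: "n \<ge> 1" and \<mu>: "sets \<mu> = sets (restrict_space borel unit_square)" "prob_space \<mu>"
    and k: "k \<in> {1..n}"
  shows "(\<Sum>j=1..n. measure \<mu> (grid_interval n k \<times> grid_interval n j)) =
      measure \<mu> (grid_interval n k \<times> {0..<1})"
    and "(\<Sum>i=1..n. measure \<mu> (grid_interval n i \<times> grid_interval n k)) =
      measure \<mu> ({0..<1} \<times> grid_interval n k)"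
proof -
  interpret prob_space \<mu> by fact
  have meas: "measure \<mu> A = (LINT z|\<mu>. indicator A z)" if "A \<in> sets \<mu>" for A
    using that by (simp add: sets.Int_space_eq2)
  have S: "grid_interval n i \<times> grid_interval n j \<in> sets \<mu>" "grid_interval n i \<times> {0..<1} \<in> sets \<mu>"
    "{0..<1} \<times> grid_interval n i \<in> sets \<mu>" if "i \<in> {1..n}" "j \<in> {1..n}" for i j
    using that grid_interval_in_unit by (auto intro!: product_in_unit_square \<mu>(1))
  have row: "(\<Sum>j=1..n. indicator (grid_interval n k \<times> grid_interval n j) z) =
      (indicator (grid_interval n k \<times> {0..<1}) z :: real)" for z
    by (simp only: indicator_times sum_distrib_left[symmetric] sum_indicator_grid_interval[OF n])
  have col: "(\<Sum>i=1..n. indicator (grid_interval n i \<times> grid_interval n k) z) =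
      (indicator ({0..<1} \<times> grid_interval n k) z :: real)" for z
    by (simp only: indicator_times sum_distrib_right[symmetric] sum_indicator_grid_interval[OF n])
  have "(\<Sum>j=1..n. measure \<mu> (grid_interval n k \<times> grid_interval n j)) =
      (\<Sum>j=1..n. LINT z|\<mu>. indicator (grid_interval n k \<times> grid_interval n j) z)"
    using k S by (intro sum.cong refl meas) auto
  also have "\<dots> = (LINT z|\<mu>. (\<Sum>j=1..n. indicator (grid_interval n k \<times> grid_interval n j) z))"
    using k S by (intro Bochner_Integration.integral_sum[symmetric]) (auto simp: less_top[symmetric])
  also have "\<dots> = measure \<mu> (grid_interval n k \<times> {0..<1})"
    unfolding row using k S by (intro meas[symmetric]) auto
  finally show "(\<Sum>j=1..n. measure \<mu> (grid_interval n k \<times> grid_interval n j)) =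
      measure \<mu> (grid_interval n k \<times> {0..<1})" .
  have "(\<Sum>i=1..n. measure \<mu> (grid_interval n i \<times> grid_interval n k)) =
      (\<Sum>i=1..n. LINT z|\<mu>. indicator (grid_interval n i \<times> grid_interval n k) z)"
    using k S by (intro sum.cong refl meas) auto
  also have "\<dots> = (LINT z|\<mu>. (\<Sum>i=1..n. indicator (grid_interval n i \<times> grid_interval n k) z))"
    using k S by (intro Bochner_Integration.integral_sum[symmetric]) (auto simp: less_top[symmetric])
  also have "\<dots> = measure \<mu> ({0..<1} \<times> grid_interval n k)"
    unfolding col using k S by (intro meas[symmetric]) auto
  finally show "(\<Sum>i=1..n. measure \<mu> (grid_interval n i \<times> grid_interval n k)) =
      measure \<mu> ({0..<1} \<times> grid_interval n k)" .
qed

lemma copula_grid_sums: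
  assumes n: "n \<ge> 1" and C: "copula C" and k: "k \<in> {1..n}"
  shows "(\<Sum>j=1..n. measure (copula_measure C) (grid_interval n k \<times> grid_interval n j)) = 1 / real n"
    and "(\<Sum>i=1..n. measure (copula_measure C) (grid_interval n i \<times> grid_interval n k)) = 1 / real n"
proof -
  have "0 \<le> (real k - 1) / real n" "(real k - 1) / real n \<le> real k / real n" "real k / real n \<le> 1"
    and diff: "real k / real n - (real k - 1) / real n = 1 / real n"
    using n k by (auto simp: divide_right_mono diff_divide_distrib)
  note strip = copula_measure_strip[OF C this(1-3)]
  show "(\<Sum>j=1..n. measure (copula_measure C) (grid_interval n k \<times> grid_interval n j)) = 1 / real n"
    using strip(1) sum_measure_grid(1)[OF n copula_measure(1,2)[OF C] k] diff
    by (simp add: grid_interval_def)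
  show "(\<Sum>i=1..n. measure (copula_measure C) (grid_interval n i \<times> grid_interval n k)) = 1 / real n"
    using strip(2) sum_measure_grid(2)[OF n copula_measure(1,2)[OF C] k] diff
    by (simp add: grid_interval_def)
qed

section \<open>The shuffle over the equipartition\<close>

lemma image_partition_equal:
  assumes \<sigma>: "\<sigma> permutes {1..n}" and "j \<le> n"
  shows "image_partition (equal_partition n) \<sigma> j = real j / real n"
proof -
  have "image_partition (equal_partition n) \<sigma> j = (\<Sum>k=1..j. 1 / real n)"
    unfolding image_partition_def
  proof (rule sum.cong[OF refl])
    fix k
    assume "k \<in> {1..j}"
    with assms(2) have "k \<in> {1..n}"
      by auto
    then have "inv \<sigma> k \<in> {1..n}"
      using permutes_in_image[OF permutes_inv[OF \<sigma>]] by blast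
    then show "equal_partition n (inv \<sigma> k) - equal_partition n (inv \<sigma> k - 1) = 1 / real n"
      by (simp add: equal_partition_def of_nat_diff diff_divide_distrib)
  qed
  then show ?thesis
    by simp
qed

definition diagonal_point :: "nat \<Rightarrow> nat \<Rightarrow> nat \<Rightarrow> real \<Rightarrow> real \<times> real" where
  "diagonal_point n i j u = ((real i - 1 + u) / real n, (real j - 1 + u) / real n)"

lemma emeasure_shuffle_segment:
  assumes \<sigma>: "\<sigma> permutes {1..n}" and i: "i \<in> {1..n}" and B: "B \<in> sets borel"
  shows "emeasure (shuffle_segment (equal_partition n) \<sigma> (\<lambda>_. 1) i) B =
    ennreal (measure lborel {u\<in>{0..1}. diagonal_point n i (\<sigma> i) u \<in> B})"
proof -
  have \<sigma>i: "\<sigma> i \<in> {1..n}"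
    using permutes_in_image[OF \<sigma>] i by blast
  have path: "(1 - u) *\<^sub>R (real (i - 1) / real n, real (\<sigma> i - 1) / real n) +
      u *\<^sub>R (real i / real n, real (\<sigma> i) / real n) = diagonal_point n i (\<sigma> i) u" for u
    using i \<sigma>i by (simp add: diagonal_point_def of_nat_diff field_simps)
  have [measurable]: "diagonal_point n i (\<sigma> i) \<in> borel \<rightarrow>\<^sub>M borel"
    unfolding diagonal_point_def[abs_def] borel_prod[symmetric] by measurable
  have t: "image_partition (equal_partition n) \<sigma> (\<sigma> i) = real (\<sigma> i) / real n"
    "image_partition (equal_partition n) \<sigma> (\<sigma> i - 1) = real (\<sigma> i - 1) / real n"
    by (intro image_partition_equal[OF \<sigma>]; use \<sigma>i in auto)+
  have "emeasure (shuffle_segment (equal_partition n) \<sigma> (\<lambda>_. 1) i) B =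
      emeasure (distr (uniform_measure lborel {0..1}) borel (diagonal_point n i (\<sigma> i))) B"
    by (simp only: shuffle_segment_def uniform_on_segment_def Let_def t equal_partition_def path simp_thms if_True)
  also have "\<dots> = emeasure lborel ({0..1} \<inter> diagonal_point n i (\<sigma> i) -` B)"
    using B measurable_sets[of "diagonal_point n i (\<sigma> i)" borel borel B]
    by (subst emeasure_distr) (simp_all add: divide_ennreal_def)
  also have "{0..1} \<inter> diagonal_point n i (\<sigma> i) -` B = {u\<in>{0..1}. diagonal_point n i (\<sigma> i) u \<in> B}"
    by auto
  also have "emeasure lborel \<dots> = ennreal (measure lborel \<dots>)"
  proof (rule emeasure_eq_ennreal_measure)
    have "emeasure lborel {u\<in>{0..1}. diagonal_point n i (\<sigma> i) u \<in> B} < \<infinity>"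
      by (rule emeasure_bounded_finite) (rule bounded_subset[of "{0..1}"], auto)
    then show "emeasure lborel {u\<in>{0..1}. diagonal_point n i (\<sigma> i) u \<in> B} \<noteq> top"
      by simp
  qed
  finally show ?thesis .
qed

lemma emeasure_equal_shuffle:
  assumes \<sigma>: "\<sigma> permutes {1..n}" and B: "B \<in> sets (restrict_space borel unit_square)"
  shows "emeasure (shuffle_measure n (equal_partition n) \<sigma> (\<lambda>_. 1)) B =
    ennreal (\<Sum>i=1..n. measure lborel {u\<in>{0..1}. diagonal_point n i (\<sigma> i) u \<in> B} / real n)"
proof -
  have "emeasure (shuffle_measure n (equal_partition n) \<sigma> (\<lambda>_. 1)) B =
      (\<Sum>i=1..n. ennreal (measure lborel {u\<in>{0..1}. diagonal_point n i (\<sigma> i) u \<in> B} / real n))"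
    unfolding emeasure_shuffle_measure[OF B]
  proof (rule sum.cong[OF refl])
    fix i
    assume i: "i \<in> {1..n}"
    then have "equal_partition n i - equal_partition n (i - 1) = 1 / real n"
      by (simp add: equal_partition_def of_nat_diff diff_divide_distrib)
    moreover have "B \<in> sets borel"
      using B by (simp add: sets_unit_square_iff)
    ultimately show "ennreal (equal_partition n i - equal_partition n (i - 1)) *
        emeasure (shuffle_segment (equal_partition n) \<sigma> (\<lambda>_. 1) i) B =
        ennreal (measure lborel {u\<in>{0..1}. diagonal_point n i (\<sigma> i) u \<in> B} / real n)"
      using i by (simp add: emeasure_shuffle_segment[OF \<sigma>] flip: ennreal_mult)
  qed
  then show ?thesis
    by simp
qed

lemma measure_equal_shuffle:
  assumes "\<sigma> permutes {1..n}" "B \<in> sets (restrict_space borel unit_square)"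
  shows "measure (shuffle_measure n (equal_partition n) \<sigma> (\<lambda>_. 1)) B =
    (\<Sum>i=1..n. measure lborel {u\<in>{0..1}. diagonal_point n i (\<sigma> i) u \<in> B} / real n)"
  unfolding measure_def[of "shuffle_measure n (equal_partition n) \<sigma> (\<lambda>_. 1)"] emeasure_equal_shuffle[OF assms]
  by (intro enn2real_ennreal sum_nonneg) simp

text \<open>The \<open>k\<close>-th term is the length of the part of the interval from
  \<open>k - 1\<close> to \<open>k\<close> that lies below \<open>z\<close>.\<close>

lemma sum_clamp:
  assumes "0 \<le> z"
  shows "(\<Sum>k=1..m. max 0 (min 1 (z - (real k - 1)))) = min (real m) z"
  using assms by (induction m) auto

lemma measure_clamp:
  "measure lborel {u\<in>{0..1}. u \<le> c} = max 0 (min 1 (c :: real))"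
proof -
  have "{u\<in>{0..1}. u \<le> c} = (if c < 0 then {} else {0..min 1 c})"
    by auto
  then show ?thesis
    by (simp only: split: if_split) (simp add: max_def min_def)
qed

text \<open>Each diagonal projects onto either side of its square at constant speed, so the
  condition on one coordinate cuts off an initial piece of the parameter interval. For the second
  coordinate the same pieces occur in the order given by \<open>\<sigma>\<close>, which does not
  change their sum.\<close>

lemma equal_shuffle_marginals:
  assumes n: "n \<ge> 1" and \<sigma>: "\<sigma> permutes {1..n}" and t: "t \<in> {0..1}"
  shows "measure (shuffle_measure n (equal_partition n) \<sigma> (\<lambda>_. 1)) ({0..t} \<times> {0..1}) = t"
    and "measure (shuffle_measure n (equal_partition n) \<sigma> (\<lambda>_. 1)) ({0..1} \<times> {0..t}) = t"
proof -
  let ?z = "real n * t"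
  have S: "{0..t} \<times> {0..1} \<in> sets (restrict_space borel unit_square)"
      "{0..1} \<times> {0..t} \<in> sets (restrict_space borel unit_square)"
    using t by (auto simp: sets_unit_square_iff borel_Times)
  have \<sigma>i: "\<sigma> i \<in> {1..n}" if "i \<in> {1..n}" for i
    using permutes_in_image[OF \<sigma>] that by blast
  have unit: "0 \<le> (real i - 1 + u) / real n" "(real i - 1 + u) / real n \<le> 1"
    if "i \<in> {1..n}" "u \<in> {0..1}" for i u
    using that n by (auto simp: divide_le_eq)
  have le_t: "(real i - 1 + u) / real n \<le> t \<longleftrightarrow> u \<le> ?z - (real i - 1)" for i u
    using n by (simp add: divide_le_eq mult.commute algebra_simps)
  have z: "0 \<le> ?z" "min (real n) ?z = ?z"
    using t by (simp_all add: mult_left_le)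
  have clamp: "(\<Sum>i=1..n. max 0 (min 1 (?z - (real i - 1))) / real n) = t"
    unfolding sum_divide_distrib[symmetric] sum_clamp[OF z(1)] z(2) using n by simp
  have "measure (shuffle_measure n (equal_partition n) \<sigma> (\<lambda>_. 1)) ({0..t} \<times> {0..1}) =
      (\<Sum>i=1..n. max 0 (min 1 (?z - (real i - 1))) / real n)"
    unfolding measure_equal_shuffle[OF \<sigma> S(1)]
  proof (rule sum.cong[OF refl])
    fix i assume i: "i \<in> {1..n}"
    have "{u\<in>{0..1}. diagonal_point n i (\<sigma> i) u \<in> {0..t} \<times> {0..1}} = {u\<in>{0..1}. u \<le> ?z - (real i - 1)}"
      using unit[OF i] unit[OF \<sigma>i[OF i]] le_t by (auto simp: diagonal_point_def)
    then show "measure lborel {u\<in>{0..1}. diagonal_point n i (\<sigma> i) u \<in> {0..t} \<times> {0..1}} / real n =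
        max 0 (min 1 (?z - (real i - 1))) / real n"
      by (simp only: measure_clamp)
  qed
  also have "\<dots> = t"
    by (rule clamp)
  finally show "measure (shuffle_measure n (equal_partition n) \<sigma> (\<lambda>_. 1)) ({0..t} \<times> {0..1}) = t" .
  have "measure (shuffle_measure n (equal_partition n) \<sigma> (\<lambda>_. 1)) ({0..1} \<times> {0..t}) =
      (\<Sum>i=1..n. max 0 (min 1 (?z - (real (\<sigma> i) - 1))) / real n)"
    unfolding measure_equal_shuffle[OF \<sigma> S(2)]
  proof (rule sum.cong[OF refl])
    fix i assume i: "i \<in> {1..n}"
    have "{u\<in>{0..1}. diagonal_point n i (\<sigma> i) u \<in> {0..1} \<times> {0..t}} =
        {u\<in>{0..1}. u \<le> ?z - (real (\<sigma> i) - 1)}"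
      using unit[OF i] unit[OF \<sigma>i[OF i]] le_t by (auto simp: diagonal_point_def)
    then show "measure lborel {u\<in>{0..1}. diagonal_point n i (\<sigma> i) u \<in> {0..1} \<times> {0..t}} / real n =
        max 0 (min 1 (?z - (real (\<sigma> i) - 1))) / real n"
      by (simp only: measure_clamp)
  qed
  also have "\<dots> = (\<Sum>i=1..n. max 0 (min 1 (?z - (real i - 1))) / real n)"
    using sum.permute[OF \<sigma>, of "\<lambda>i. max 0 (min 1 (?z - (real i - 1))) / real n"] by (simp add: comp_def)
  also have "\<dots> = t"
    by (rule clamp)
  finally show "measure (shuffle_measure n (equal_partition n) \<sigma> (\<lambda>_. 1)) ({0..1} \<times> {0..t}) = t" .
qed

lemma prob_space_equal_shuffle:
  assumes n: "n \<ge> 1" and \<sigma>: "\<sigma> permutes {1..n}"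
  shows "prob_space (shuffle_measure n (equal_partition n) \<sigma> (\<lambda>_. 1))"
proof (rule prob_spaceI)
  let ?\<mu> = "shuffle_measure n (equal_partition n) \<sigma> (\<lambda>_. 1)"
  have sp: "space ?\<mu> = unit_square"
    by (rule space_unit_square) (rule sets_shuffle_measure)
  have S: "unit_square \<in> sets (restrict_space borel unit_square)"
    by (simp add: sets_unit_square_iff borel_Times)
  have "emeasure ?\<mu> unit_square = ennreal (measure ?\<mu> unit_square)"
    unfolding measure_equal_shuffle[OF \<sigma> S] by (rule emeasure_equal_shuffle[OF \<sigma> S])
  then show "emeasure ?\<mu> (space ?\<mu>) = 1"
    using equal_shuffle_marginals(1)[OF n \<sigma>, of 1] by (simp add: sp)
qed

text \<open>The shuffle enters the theorem as a distribution function, from which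
  \<open>copula_measure\<close> recovers a measure. Uniqueness identifies it with the explicit sum
  of segment measures, so cell masses can be computed.\<close>

lemma equal_shuffle_copula:
  assumes n: "n \<ge> 1" and \<sigma>: "\<sigma> permutes {1..n}"
  shows "copula (shuffle_of_M n (equal_partition n) \<sigma> (\<lambda>_. 1))"
    and "copula_measure (shuffle_of_M n (equal_partition n) \<sigma> (\<lambda>_. 1)) =
      shuffle_measure n (equal_partition n) \<sigma> (\<lambda>_. 1)"
proof -
  show "copula (shuffle_of_M n (equal_partition n) \<sigma> (\<lambda>_. 1))"
    unfolding shuffle_of_M_def[abs_def]
    by (intro copula_of_measure sets_shuffle_measure prob_space_equal_shuffle equal_shuffle_marginals n \<sigma>)
  show "copula_measure (shuffle_of_M n (equal_partition n) \<sigma> (\<lambda>_. 1)) =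
      shuffle_measure n (equal_partition n) \<sigma> (\<lambda>_. 1)"
    by (intro copula_measure_eq sets_shuffle_measure prob_space_equal_shuffle n \<sigma>)
      (simp add: shuffle_of_M_def)
qed

text \<open>Only the bound from below for the cell on \<open>\<sigma> i\<close> is computed. Every
  copula gives the whole row mass \<open>1 / n\<close>, so this cell exhausts it and the others in
  the row are null; no check that the other segments avoid them is required.\<close>

lemma equal_shuffle_grid:
  assumes n: "n \<ge> 1" and \<sigma>: "\<sigma> permutes {1..n}" and ij: "i \<in> {1..n}" "j \<in> {1..n}"
  shows "measure (shuffle_measure n (equal_partition n) \<sigma> (\<lambda>_. 1)) (grid_interval n i \<times> grid_interval n j) =
    (if j = \<sigma> i then 1 / real n else 0)"
proof -
  let ?m = "\<lambda>j. measure (shuffle_measure n (equal_partition n) \<sigma> (\<lambda>_. 1)) (grid_interval n i \<times> grid_interval n j)"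
  have \<sigma>i: "\<sigma> i \<in> {1..n}"
    using permutes_in_image[OF \<sigma>] ij(1) by blast
  have S: "grid_interval n i \<times> grid_interval n (\<sigma> i) \<in> sets (restrict_space borel unit_square)"
    using grid_interval_in_unit ij(1) \<sigma>i by (intro product_in_unit_square) auto
  \<comment> \<open>The parameter 1 drops out because the upper right corner is not in the half-open
    cell.\<close>
  have "{u\<in>{0..1}. diagonal_point n i (\<sigma> i) u \<in> grid_interval n i \<times> grid_interval n (\<sigma> i)} = {0..<1}"
    using n by (auto simp: diagonal_point_def grid_interval_def divide_right_mono divide_strict_right_mono
        divide_less_cancel divide_le_cancel)
  then have "1 / real n = measure lborel
      {u\<in>{0..1}. diagonal_point n i (\<sigma> i) u \<in> grid_interval n i \<times> grid_interval n (\<sigma> i)} / real n"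
    by simp
  also have "\<dots> \<le> ?m (\<sigma> i)"
    unfolding measure_equal_shuffle[OF \<sigma> S] using ij(1)
    by (intro member_le_sum[of i "{1..n}" "\<lambda>k. measure lborel {u\<in>{0..1}. diagonal_point n k (\<sigma> k) u \<in>
        grid_interval n i \<times> grid_interval n (\<sigma> i)} / real n"]) auto
  finally have ge: "1 / real n \<le> ?m (\<sigma> i)" .
  have "(\<Sum>j=1..n. ?m j) = 1 / real n"
    using copula_grid_sums(1)[OF n equal_shuffle_copula(1)[OF n \<sigma>] ij(1)]
    by (simp add: equal_shuffle_copula(2)[OF n \<sigma>])
  then have total: "?m (\<sigma> i) + (\<Sum>j\<in>{1..n} - {\<sigma> i}. ?m j) = 1 / real n"
    using \<sigma>i by (simp add: sum.remove)
  have nonneg: "0 \<le> (\<Sum>j\<in>{1..n} - {\<sigma> i}. ?m j)"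
    by (intro sum_nonneg) simp
  then have "(\<Sum>j\<in>{1..n} - {\<sigma> i}. ?m j) = 0"
    using ge total by linarith
  then have "\<forall>j\<in>{1..n} - {\<sigma> i}. ?m j = 0"
    by (subst (asm) sum_nonneg_eq_0_iff) auto
  then show ?thesis
    using ge total nonneg ij(2) by auto
qed

theorem theorem5p1p5:
  fixes n :: nat and a :: "nat \<Rightarrow> nat \<Rightarrow> real" and f :: "real \<times> real \<Rightarrow> real"
    and \<sigma>star :: "nat \<Rightarrow> nat"
  assumes "n \<ge> 1"
    and "\<And>i j x y. i \<in> {1..n} \<Longrightarrow> j \<in> {1..n} \<Longrightarrow>
           x \<in> {(real i - 1) / real n..<real i / real n} \<Longrightarrow>
           y \<in> {(real j - 1) / real n..<real j / real n} \<Longrightarrow> f (x, y) = a i j"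
    and "is_arg_max (\<lambda>\<sigma>. \<Sum>i=1..n. a i (\<sigma> i)) (\<lambda>\<sigma>. \<sigma> permutes {1..n}) \<sigma>star"
  defines "C_max \<equiv> shuffle_of_M n (equal_partition n) \<sigma>star (\<lambda>_. 1)"
  shows "is_arg_max (copula_integral f) copula C_max \<and>
         copula_integral f C_max = (1 / real n) * (\<Sum>i=1..n. a i (\<sigma>star i))"
proof -
  have \<sigma>: "\<sigma>star permutes {1..n}"
    using assms(3) by (simp add: is_arg_max_def)
  have C_max: "copula C_max"
    and C_max_measure: "copula_measure C_max = shuffle_measure n (equal_partition n) \<sigma>star (\<lambda>_. 1)"
    using equal_shuffle_copula[OF assms(1) \<sigma>] by (simp_all add: C_max_def)
  have int: "copula_integral f C = (\<Sum>i=1..n. \<Sum>j=1..n.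
      measure (copula_measure C) (grid_interval n i \<times> grid_interval n j) * a i j)" if "copula C" for C
    unfolding copula_integral_def using that
    by (intro integral_step_function assms(1) copula_measure) (auto simp: grid_interval_def intro!: assms(2))
  have max_value: "copula_integral f C_max = (1 / real n) * (\<Sum>i=1..n. a i (\<sigma>star i))"
  proof -
    have "copula_integral f C_max = (\<Sum>i=1..n. \<Sum>j=1..n. if j = \<sigma>star i then 1 / real n * a i j else 0)"
      unfolding int[OF C_max] C_max_measure
      by (intro sum.cong refl) (simp add: equal_shuffle_grid[OF assms(1) \<sigma>])
    also have "\<dots> = (\<Sum>i=1..n. 1 / real n * a i (\<sigma>star i))"
      using permutes_in_image[OF \<sigma>] by (intro sum.cong refl) (subst sum.delta, auto)
    finally show ?thesis
      by (simp only: sum_distrib_left)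
  qed
  \<comment> \<open>The cell masses of \<open>C\<close> serve as the weights, and their row and
    column sums supply the factor \<open>1 / n\<close> as the constant \<open>c\<close> of the
    bound.\<close>
  have "copula_integral f C \<le> copula_integral f C_max" if C: "copula C" for C
    unfolding max_value int[OF C]
    by (rule assignment_bound[OF _ _ _ _ assms(3)]) (simp_all add: copula_grid_sums[OF assms(1) C, simplified])
  then show ?thesis
    using C_max max_value by (auto simp: is_arg_max_def not_less)
qed

end
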